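(* Let $K\ge1$ and $\alpha\in[1,2]$. Suppose that $f(z)=h(z)+\overline{g(z)}=\sum_{n=0}^\infty a_nz^n+\overline{\sum_{n=1}^\infty b_nz^n}$ is a sense-preserving $K$-quasiconformal harmonic mapping in $\mathbb{D}$ and $h\prec\phi$, where $\phi\in\widehat{C_0}(\alpha)$. Then $$|h(z)|+\sum_{n=1}^\infty\left(|a_n|+|b_n|\right)r^n\le|\phi(0)|+d(\phi(0),\partial\phi(\mathbb{D}))\quad\text{for } |z|=r\le r_0,$$ where $r_0\in(0,1/3)$ is the unique root in $(0,1/3)$ of the equation $$\left(\frac{3K+1}{K+1}\right)\left(\left(\frac{1+r}{1-r}\right)^\alpha-1\right)-1=0.$$ The number $r_0$ is sharp: for given $K$ and $\alpha$ it cannot be replaced by any larger number for which the inequality holds for all such $f$ and $\phi$.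
   Context: $\mathbb{D}=\{z\in\mathbb{C}:|z|<1\}$. A harmonic mapping in $\mathbb{D}$ is written $f=h+\overline{g}$ with $h,g$ analytic in $\mathbb{D}$. It is locally univalent and sense-preserving if $h'\neq0$ in $\mathbb{D}$ and the dilatation $\omega=g'/h'$ satisfies $|\omega|<1$ in $\mathbb{D}$. Such an $f$ is called $K$-quasiconformal for $K\ge1$ if $|\omega(z)|\le k<1$ for all $z\in\mathbb{D}$, where $K=(1+k)/(1-k)$, i.e. $k=(K-1)/(K+1)$. For analytic $h,\phi$ in $\mathbb{D}$, $h\prec\phi$ (subordination) means $h=\phi\circ w$ for some analytic $w:\mathbb{D}\to\mathbb{D}$ with $w(0)=0$. $d(\phi(0),\partial\phi(\mathbb{D}))$ is the Euclidean distance from $\phi(0)$ to the boundary of $\phi(\mathbb{D})$. $\mathcal{A}$ is the class of analytic functions $\phi$ on $\mathbb{D}$ with $\phi(0)=\phi'(0)-1=0$. For $\alpha\in[1,2]$, $\widehat{C_0}(\alpha)$ (concave univalent functions with opening angle $\pi\alpha$ at infinity) is the class of functions $\phi:\mathbb{D}\to\mathbb{C}$ such that: (i) $\phi\in\mathcal{A}$ and $\phi(1)=\infty$ (i.e. $\phi(z)\to\infty$ as $z\to1$ in $\mathbb{D}$); (ii) $\phi$ maps $\mathbb{D}$ conformally (injectively) onto a set whose complement with respect to $\mathbb{C}$ is convex; (iii) the opening angle of $\phi(\mathbb{D})$ at infinity is less than or equal to $\pi\alpha$. Here, for a domain $G$ whose complement $E=\mathbb{C}\setminus G$ is closed, convex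 and unbounded, the opening angle of $G$ at infinity is $2\pi-\beta$, where $\beta\in[0,\pi]$ is the angle of the recession cone $\{v\in\mathbb{C}: x+tv\in E \text{ for all } x\in E,\ t\ge0\}$ of $E$ (e.g. $\pi$ for a half-plane $G$, $2\pi$ for the plane slit along a ray). *)

theory Defs
  imports "HOL-Complex_Analysis.Complex_Analysis"
begin

definition harmonic_mapping ::
  "(complex \<Rightarrow> complex) \<Rightarrow> (complex \<Rightarrow> complex) \<Rightarrow> (complex \<Rightarrow> complex) \<Rightarrow> bool" where
  "harmonic_mapping f h g \<longleftrightarrow>
     h holomorphic_on ball 0 1 \<and> g holomorphic_on ball 0 1 \<and>
     (\<forall>z\<in>ball 0 1. f z = h z + cnj (g z))"

definition dilatation :: "(complex \<Rightarrow> complex) \<Rightarrow> (complex \<Rightarrow> complex) \<Rightarrow> complex \<Rightarrow> complex" where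
  "dilatation h g z = deriv g z / deriv h z"

definition sense_preserving :: "(complex \<Rightarrow> complex) \<Rightarrow> (complex \<Rightarrow> complex) \<Rightarrow> bool" where
  "sense_preserving h g \<longleftrightarrow>
     (\<forall>z\<in>ball 0 1. deriv h z \<noteq> 0 \<and> norm (dilatation h g z) < 1)"

text \<open>The bound is \<open>k = (K - 1) / (K + 1)\<close>, that is, \<open>K = (1 + k) / (1 - k)\<close>.\<close>

definition quasiconformal :: "real \<Rightarrow> (complex \<Rightarrow> complex) \<Rightarrow> (complex \<Rightarrow> complex) \<Rightarrow> bool" where
  "quasiconformal K h g \<longleftrightarrow>
     1 \<le> K \<and> (\<forall>z\<in>ball 0 1. norm (dilatation h g z) \<le> (K - 1) / (K + 1))"

definition subordinate :: "(complex \<Rightarrow> complex) \<Rightarrow> (complex \<Rightarrow> complex) \<Rightarrow> bool" where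
  "subordinate h \<phi> \<longleftrightarrow>
     (\<exists>w. w holomorphic_on ball 0 1 \<and> w ` ball 0 1 \<subseteq> ball 0 1 \<and> w 0 = 0 \<and>
          (\<forall>z\<in>ball 0 1. h z = \<phi> (w z)))"

definition recession_cone :: "complex set \<Rightarrow> complex set" where
  "recession_cone E = {v. \<forall>x\<in>E. \<forall>t\<ge>0. x + t *\<^sub>R v \<in> E}"

text \<open>
  The angle of a closed convex cone in the plane is the largest unsigned angle
  \<open>\<bar>Arg (u / v)\<bar> \<in> [0, \<pi>]\<close> between two of its nonzero vectors: \<open>0\<close> for a ray, the
  opening for a sector, \<open>\<pi>\<close> for a half-plane. It is only meant for cones other than
  \<open>{0}\<close>, a full line and the whole plane. The recession cone of the complement of
  \<open>\<phi> ` ball 0 1\<close> is never one of these when \<open>\<phi>\<close> satisfies the other conditions of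
  \<open>concave_class\<close>: that complement is unbounded, because the image is simply connected
  and not the whole plane, and it is not a strip or a line, because the image is connected.
\<close>

definition cone_angle :: "complex set \<Rightarrow> real" where
  "cone_angle C = Sup {\<bar>Arg (u / v)\<bar> | u v. u \<in> C - {0} \<and> v \<in> C - {0}}"

definition opening_angle :: "complex set \<Rightarrow> real" where
  "opening_angle G = 2 * pi - cone_angle (recession_cone (- G))"

definition concave_class :: "real \<Rightarrow> (complex \<Rightarrow> complex) set" where
  "concave_class \<alpha> =
     {\<phi>. \<phi> holomorphic_on ball 0 1 \<and> \<phi> 0 = 0 \<and> deriv \<phi> 0 = 1 \<and>
         filterlim \<phi> at_infinity (at 1 within ball 0 1) \<and>
         inj_on \<phi> (ball 0 1) \<and> convex (- (\<phi> ` ball 0 1)) \<and>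
         opening_angle (\<phi> ` ball 0 1) \<le> pi * \<alpha>}"

text \<open>
  \<open>bohr_inequality_upto K \<alpha> R\<close>: the inequality holds for all admissible \<open>f\<close> and \<open>\<phi>\<close> and all
  points \<open>z\<close> of the unit disc with \<open>norm z \<le> R\<close>. The series for \<open>g\<close> starts at \<open>n = 1\<close>,
  so \<open>g 0 = 0\<close> and \<open>b 0\<close> plays no role.
\<close>

definition bohr_inequality_upto :: "real \<Rightarrow> real \<Rightarrow> real \<Rightarrow> bool" where
  "bohr_inequality_upto K \<alpha> R \<longleftrightarrow>
     (\<forall>f h g \<phi> a b.
        harmonic_mapping f h g \<longrightarrow>
        (\<forall>z\<in>ball 0 1. (\<lambda>n. a n * z ^ n) sums h z) \<longrightarrow>
        (\<forall>z\<in>ball 0 1. (\<lambda>n. b (Suc n) * z ^ Suc n) sums g z) \<longrightarrow>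
        sense_preserving h g \<longrightarrow> quasiconformal K h g \<longrightarrow>
        \<phi> \<in> concave_class \<alpha> \<longrightarrow> subordinate h \<phi> \<longrightarrow>
        (\<forall>z\<in>ball 0 1. norm z \<le> R \<longrightarrow>
           norm (h z) + (\<Sum>n. (norm (a (Suc n)) + norm (b (Suc n))) * norm z ^ Suc n)
             \<le> norm (\<phi> 0) + infdist (\<phi> 0) (frontier (\<phi> ` ball 0 1))))"

definition bohr_equation :: "real \<Rightarrow> real \<Rightarrow> real \<Rightarrow> bool" where
  "bohr_equation K \<alpha> r \<longleftrightarrow>
     (3 * K + 1) / (K + 1) * (((1 + r) / (1 - r)) powr \<alpha> - 1) - 1 = 0"

end

theory Submission
  imports Defs
begin

text \<open>
  Let \<open>E\<close> be the complement of \<open>\<phi> ` ball 0 1\<close>, let \<open>p\<close> be its point nearest to \<open>0\<close> and \<open>d = \<bar>p\<bar>\<close>. The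
  translate to \<open>p\<close> of the recession cone of \<open>E\<close> lies in \<open>E\<close>, so that \<open>1 - \<phi> / p\<close> takes values in a
  sector of opening \<open>\<pi> \<alpha>\<close> with vertex \<open>0\<close>, in general not symmetric about the real axis. Hence
  \<open>1 - h / p\<close> is subordinate to \<open>F\<^sub>c z = ((1 + c z) / (1 - z)) powr \<alpha>\<close> for some \<open>\<bar>c\<bar> = 1\<close>, and since
  a Schwarz function \<open>w\<close> has majorant series at most \<open>r\<close> for small \<open>r\<close>, it suffices to compare the
  majorant series of \<open>F\<^sub>c\<close> with that of \<open>F\<^sub>1\<close>. This is done for the derivatives: \<open>F\<^sub>c'\<close> is
  \<open>\<alpha> (1 + c)\<close> times the exponential of an explicit power series, and for \<open>r \<le> 1/5\<close> the loss in the
  even coefficients of that series is made up by the factor \<open>\<bar>1 + c\<bar> / 2\<close>. Thus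
  \<open>\<Sum>\<bar>a\<^sub>n\<bar> r\<^sup>n \<le> d (((1 + r) / (1 - r)) powr \<alpha> - 1)\<close>, and \<open>g' = \<omega> h'\<close> with \<open>\<bar>\<omega>\<bar> \<le> k\<close> gives
  \<open>\<Sum>\<bar>b\<^sub>n\<bar> r\<^sup>n \<le> k \<Sum>\<bar>a\<^sub>n\<bar> r\<^sup>n\<close>. Equality holds for \<open>h = \<phi> = (F\<^sub>1 - 1) / (2 \<alpha>)\<close> and \<open>g = k h\<close>.
\<close>

subsection \<open>Majorant series and Bohr's inequality\<close>

text \<open>Truncating at \<open>N\<close> turns products and compositions into statements about
  finitely many coefficients of formal power series; the later bounds are uniform in
  \<open>N\<close>.\<close>

definition majorant :: "nat \<Rightarrow> real \<Rightarrow> complex fps \<Rightarrow> real" where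
  "majorant N r F = (\<Sum>n\<le>N. norm (fps_nth F n) * r ^ n)"

lemma majorant_nonneg: "0 \<le> r \<Longrightarrow> 0 \<le> majorant N r F"
  by (auto simp: majorant_def intro!: sum_nonneg)

lemma majorant_1: "majorant N r 1 = 1"
  by (simp add: majorant_def if_distrib if_distribR sum.delta cong: if_cong)

lemma majorant_const: "majorant N r (fps_const c) = norm c"
  by (simp add: majorant_def if_distrib if_distribR sum.delta cong: if_cong)

lemma majorant_add:
  assumes "0 \<le> r"
  shows "majorant N r (F + G) \<le> majorant N r F + majorant N r G"
proof -
  have "norm (fps_nth (F + G) n) * r ^ n \<le> norm (fps_nth F n) * r ^ n + norm (fps_nth G n) * r ^ n" for n
    using assms by (simp add: norm_triangle_ineq mult_right_mono flip: distrib_right)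
  then show ?thesis
    by (simp add: majorant_def sum_mono flip: sum.distrib)
qed

lemma majorant_uminus: "majorant N r (- F) = majorant N r F"
  by (simp add: majorant_def)

text \<open>The Cauchy product sums over the triangle \<open>i + j \<le> N\<close>; enlarging it to
  a square, with nonnegative terms, makes the sum factor.\<close>

lemma majorant_mult:
  assumes "0 \<le> r"
  shows "majorant N r (F * G) \<le> majorant N r F * majorant N r G"
proof -
  let ?f = "\<lambda>i. norm (fps_nth F i) * r ^ i" and ?g = "\<lambda>i. norm (fps_nth G i) * r ^ i"
  have "majorant N r (F * G) \<le> (\<Sum>n\<le>N. \<Sum>i\<le>n. ?f i * ?g (n - i))"
    unfolding majorant_def
  proof (rule sum_mono)
    fix n assume "n \<in> {..N}"
    have "norm (fps_nth (F * G) n) * r ^ n \<le> (\<Sum>i\<le>n. norm (fps_nth F i * fps_nth G (n - i))) * r ^ n"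
      using assms by (intro mult_right_mono) (auto simp: fps_mult_nth atLeast0AtMost intro!: norm_sum)
    also have "\<dots> = (\<Sum>i\<le>n. ?f i * ?g (n - i))"
      unfolding sum_distrib_right
      by (intro sum.cong) (auto simp: norm_mult simp flip: power_add)
    finally show "norm (fps_nth (F * G) n) * r ^ n \<le> (\<Sum>i\<le>n. ?f i * ?g (n - i))" .
  qed
  also have "\<dots> = (\<Sum>(i,j)\<in>{(i,j). i + j \<le> N}. ?f i * ?g j)"
    by (rule sum.triangle_reindex_eq [symmetric])
  also have "\<dots> \<le> (\<Sum>(i,j)\<in>{..N} \<times> {..N}. ?f i * ?g j)"
    using assms by (intro sum_mono2) auto
  also have "\<dots> = majorant N r F * majorant N r G"
    by (simp add: majorant_def sum_product sum.cartesian_product)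
  finally show ?thesis .
qed

lemma majorant_power:
  assumes "0 \<le> r"
  shows "majorant N r (F ^ k) \<le> majorant N r F ^ k"
proof (induction k)
  case (Suc k)
  have "majorant N r (F ^ Suc k) \<le> majorant N r F * majorant N r (F ^ k)"
    using majorant_mult [OF assms] by simp
  also have "\<dots> \<le> majorant N r F * majorant N r F ^ k"
    using Suc by (intro mult_left_mono majorant_nonneg assms)
  finally show ?case by simp
qed (simp add: majorant_1)

text \<open>Since \<open>W\<close> has no constant term, \<open>W ^ k\<close> starts in degree at
  least \<open>k\<close>, so only the coefficients of \<open>F\<close> up to \<open>N\<close>
  enter.\<close>

lemma majorant_compose:
  assumes "0 \<le> r" "fps_nth W 0 = 0"
  shows "majorant N r (F oo W) \<le> (\<Sum>k\<le>N. norm (fps_nth F k) * majorant N r W ^ k)"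
proof -
  have nth: "fps_nth (F oo W) n = (\<Sum>k\<le>N. fps_nth F k * fps_nth (W ^ k) n)" if "n \<le> N" for n
  proof -
    have "(\<Sum>k\<le>N. fps_nth F k * fps_nth (W ^ k) n) = (\<Sum>k\<le>n. fps_nth F k * fps_nth (W ^ k) n)"
      using that assms by (intro sum.mono_neutral_right) (auto simp: startsby_zero_power_prefix)
    then show ?thesis
      by (simp add: fps_compose_nth atLeast0AtMost)
  qed
  have "majorant N r (F oo W) \<le> (\<Sum>n\<le>N. (\<Sum>k\<le>N. norm (fps_nth F k) * norm (fps_nth (W ^ k) n)) * r ^ n)"
    unfolding majorant_def
    by (intro sum_mono mult_right_mono)
       (auto simp: nth norm_mult assms intro!: order.trans [OF norm_sum])
  also have "\<dots> = (\<Sum>k\<le>N. norm (fps_nth F k) * majorant N r (W ^ k))"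
    unfolding majorant_def sum_distrib_left sum_distrib_right
    by (subst sum.swap) (simp add: mult.assoc)
  also have "\<dots> \<le> (\<Sum>k\<le>N. norm (fps_nth F k) * majorant N r W ^ k)"
    by (intro sum_mono mult_left_mono majorant_power assms) auto
  finally show ?thesis .
qed

text \<open>Cauchy's estimate on the circle of radius \<open>\<rho>\<close>, with
  \<open>\<rho>\<close> tending to 1 from below.\<close>

lemma norm_fps_nth_le:
  assumes holf: "f holomorphic_on ball 0 1" and bound: "\<And>z. norm z < 1 \<Longrightarrow> norm (f z) \<le> B"
    and F: "f has_fps_expansion F"
  shows "norm (fps_nth F n) \<le> B"
proof (rule tendsto_le)
  show "((\<lambda>\<rho>::real. norm (fps_nth F n)) \<longlongrightarrow> norm (fps_nth F n)) (at_left 1)" by simp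
  show "((\<lambda>\<rho>::real. B / \<rho> ^ n) \<longlongrightarrow> B) (at_left 1)"
    by (auto intro!: tendsto_eq_intros)
  show "eventually (\<lambda>\<rho>::real. norm (fps_nth F n) \<le> B / \<rho> ^ n) (at_left 1)"
  proof (rule eventually_at_leftI [of 0])
    fix \<rho> :: real assume \<rho>: "\<rho> \<in> {0<..<1}"
    have "cball 0 \<rho> \<subseteq> ball (0::complex) 1" using \<rho> by auto
    then have "norm ((deriv ^^ n) f 0) \<le> fact n * B / \<rho> ^ n"
      using \<rho> holf bound
      by (intro Cauchy_inequality holomorphic_on_imp_continuous_on)
         (auto elim: holomorphic_on_subset)
    then show "norm (fps_nth F n) \<le> B / \<rho> ^ n"
      by (simp add: fps_nth_fps_expansion [OF F] norm_divide field_simps)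
  qed auto
qed auto

lemma sum_power_le:
  fixes r :: real
  assumes "0 \<le> r" "r \<le> 1/4"
  shows "(\<Sum>n\<in>{1..N}. r ^ n) \<le> 1/3"
proof -
  have "(\<Sum>n\<in>{1..N}. r ^ n) \<le> (\<Sum>n\<in>{1..N}. (1/4) ^ n)"
    using assms by (intro sum_mono power_mono) auto
  also have "\<dots> = (1 - (1/4)^N) / 3"
  proof (induction N)
    case (Suc N)
    have "(\<Sum>n\<in>{1..Suc N}. (1/4::real) ^ n) = (\<Sum>n\<in>{1..N}. (1/4) ^ n) + (1/4) ^ N / 4"
      by simp
    then show ?case unfolding Suc by simp
  qed simp
  also have "\<dots> \<le> 1/3" by simp
  finally show ?thesis .
qed

text \<open>
  With \<open>a = f 0\<close>, the function \<open>W = (f - a) / (1 - cnj a * f)\<close> maps the disc into itself and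
  \<open>f - a = (1 - \<bar>a\<bar>\<^sup>2) W - cnj a * W * (f - a)\<close>. The Cauchy estimates for \<open>W\<close> are enough
  for the radius \<open>1/4\<close>; the optimal radius \<open>1/3\<close> would need sharper coefficient bounds.
\<close>

lemma Bohr_inequality_strict:
  assumes holf: "f holomorphic_on ball 0 1" and bound: "\<And>z. norm z < 1 \<Longrightarrow> norm (f z) < 1"
    and F: "f has_fps_expansion F" and r: "0 \<le> r" "r \<le> 1/4"
  shows "majorant N r F \<le> 1"
proof -
  define a where "a = f 0"
  have a1: "norm a < 1" using bound [of 0] by (simp add: a_def)
  define W where "W z = (f z - a) / (1 - cnj a * f z)" for z
  have nz: "1 - cnj a * f z \<noteq> 0" if "norm z < 1" for z
  proof -
    have "norm (cnj a * f z) < 1"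
      using mult_strict_mono' [OF a1 bound [OF that]] by (simp add: norm_mult)
    then show ?thesis by auto
  qed
  have holW: "W holomorphic_on ball 0 1"
    unfolding W_def using nz by (intro holomorphic_intros holf) auto
  have W1: "norm (W z) \<le> 1" if "norm z < 1" for z
    using Moebius_function_norm_lt_1 [OF a1 bound [OF that], of 0]
    by (simp add: Moebius_function_def W_def)
  define V where "V = fps_expansion W 0"
  have V: "W has_fps_expansion V"
    unfolding V_def using holW by (intro has_fps_expansion_fps_expansion [of "ball 0 1"]) auto
  have F0: "fps_nth F 0 = a" and V0: "fps_nth V 0 = 0"
    using has_fps_expansion_imp_0_eq_fps_nth_0 [OF F] has_fps_expansion_imp_0_eq_fps_nth_0 [OF V]
    by (auto simp: a_def W_def)
  define G where "G = F - fps_const a"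
  have G: "(\<lambda>z. f z - a) has_fps_expansion G"
    unfolding G_def by (intro fps_expansion_intros F)
  have 1: "(\<lambda>z. (1 - cnj a * a) * W z - cnj a * (W z * (f z - a))) has_fps_expansion
          (fps_const (1 - cnj a * a) * V - fps_const (cnj a) * (V * G))"
    by (intro fps_expansion_intros V G)
  have 2: "eventually (\<lambda>z. (1 - cnj a * a) * W z - cnj a * (W z * (f z - a)) = f z - a) (nhds 0)"
  proof (rule eventually_nhds_in_open [of "ball 0 1", THEN eventually_mono])
    fix z :: complex assume "z \<in> ball 0 1"
    then have "1 - cnj a * f z \<noteq> 0" using nz by simp
    then show "(1 - cnj a * a) * W z - cnj a * (W z * (f z - a)) = f z - a"
      by (simp add: W_def divide_simps) (simp add: algebra_simps)
  qed auto
  have "(\<lambda>z. f z - a) has_fps_expansion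
          (fps_const (1 - cnj a * a) * V - fps_const (cnj a) * (V * G))"
    using 1 has_fps_expansion_cong [OF 2 refl] by (rule iffD1 [rotated])
  from fps_expansion_unique_complex [OF G this] have Geq: "G = fps_const (1 - cnj a * a) * V + - (fps_const (cnj a) * (V * G))"
    by (simp only: diff_conv_add_uminus)
  define m where "m = majorant N r V"
  define x where "x = norm a"
  have x: "0 \<le> x" "x < 1" using a1 by (auto simp: x_def)
  have "m = (\<Sum>n\<in>{1..N}. norm (fps_nth V n) * r ^ n)"
    unfolding m_def majorant_def
    by (intro sum.mono_neutral_right) (auto simp: V0 Suc_le_eq)
  also have "\<dots> \<le> (\<Sum>n\<in>{1..N}. 1 * r ^ n)"
    using r by (intro sum_mono mult_right_mono norm_fps_nth_le [OF holW W1 V]) auto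
  finally have m: "m \<le> 1/3" "0 \<le> m"
    using sum_power_le [OF r, of N] majorant_nonneg [OF r(1)] by (auto simp: m_def)
  have n1: "norm (1 - cnj a * a) = 1 - x\<^sup>2"
  proof -
    have "1 - cnj a * a = of_real (1 - x\<^sup>2)"
      by (simp add: x_def complex_norm_square mult.commute del: of_real_power)
    then show ?thesis using x by (simp add: abs_square_le_1 del: of_real_diff)
  qed
  have "majorant N r G \<le> majorant N r (fps_const (1 - cnj a * a) * V) + majorant N r (fps_const (cnj a) * (V * G))"
    by (subst Geq) (metis majorant_add majorant_uminus r(1))
  also have "majorant N r (fps_const (1 - cnj a * a) * V) \<le> (1 - x\<^sup>2) * m"
    using majorant_mult [OF r(1), of N "fps_const (1 - cnj a * a)" V]
    by (simp add: majorant_const n1 m_def)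
  also have "majorant N r (fps_const (cnj a) * (V * G)) \<le> x * (m * majorant N r G)"
    using majorant_mult [OF r(1), of N "fps_const (cnj a)" "V * G"]
      mult_left_mono [OF majorant_mult [OF r(1), of N V G] x(1)]
    by (simp add: majorant_const m_def x_def)
  finally have *: "majorant N r G * (1 - x * m) \<le> (1 - x\<^sup>2) * m"
    by (simp add: algebra_simps)
  have "(1 - x\<^sup>2) * m = (1 - x) * (m + x * m)" by (simp add: power2_eq_square algebra_simps)
  \<comment> \<open>Here \<open>m \<le> 1/3\<close> enters:
    \<open>m + x * m \<le> 2/3 \<le> 1 - x * m\<close>. Cancelling the positive factor
    \<open>1 - x * m\<close> then bounds the majorant of \<open>G\<close> by
    \<open>1 - x\<close>.\<close>
  also have "\<dots> \<le> (1 - x) * (1 - x * m)"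
  proof (rule mult_left_mono)
    have "x * m \<le> 1 * (1/3)" using x m by (intro mult_mono) auto
    then show "m + x * m \<le> 1 - x * m" using m by linarith
  qed (use x in auto)
  finally have "majorant N r G * (1 - x * m) \<le> (1 - x) * (1 - x * m)"
    using * by simp
  moreover have "x * m < 1" using mult_left_le_one_le [of m x] x m by simp
  ultimately have "majorant N r G \<le> 1 - x" by simp
  moreover have "majorant N r F \<le> majorant N r G + x"
    using majorant_add [OF r(1), of N G "fps_const a"] by (simp add: G_def majorant_const x_def)
  ultimately show ?thesis by simp
qed

text \<open>The strict case is applied to \<open>f / k'\<close> for every \<open>k' > k\<close>,
  which also covers \<open>k = 0\<close> and values of modulus exactly \<open>k\<close>.\<close>

lemma Bohr_inequality:
  assumes holf: "f holomorphic_on ball 0 1" and bound: "\<And>z. norm z < 1 \<Longrightarrow> norm (f z) \<le> k"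
    and F: "f has_fps_expansion F" and r: "0 \<le> r" "r \<le> 1/4"
  shows "majorant N r F \<le> k"
proof (rule dense_ge)
  fix k' assume k': "k < k'"
  have "0 \<le> k" using order.trans [OF norm_ge_zero bound [of 0]] by simp
  with k' have pos: "0 < k'" by simp
  have "majorant N r (fps_const (of_real (1 / k')) * F) \<le> 1"
  proof (rule Bohr_inequality_strict [OF _ _ _ r])
    show "(\<lambda>z. of_real (1 / k') * f z) holomorphic_on ball 0 1"
      by (intro holomorphic_intros holf)
    show "(\<lambda>z. of_real (1 / k') * f z) has_fps_expansion fps_const (of_real (1 / k')) * F"
      by (intro fps_expansion_intros F)
    show "norm (of_real (1 / k') * f z) < 1" if "norm z < 1" for z
      using bound [OF that] k' pos by (simp add: norm_mult norm_divide)
  qed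
  moreover have "majorant N r (fps_const (of_real (1 / k')) * F) = majorant N r F / k'"
    using pos by (simp add: majorant_def norm_mult norm_divide sum_divide_distrib)
  ultimately show "majorant N r F \<le> k'" using pos by simp
qed

lemma majorant_fps_X: "0 \<le> r \<Longrightarrow> majorant N r fps_X \<le> r"
  by (cases "N = 0") (auto simp: majorant_def if_distrib if_distribR sum.delta cong: if_cong)

text \<open>The Schwarz lemma gives \<open>w z = z * v z\<close> with \<open>v\<close> bounded by 1;
  Bohr's inequality for \<open>v\<close> then leaves the factor \<open>r\<close>.\<close>

lemma majorant_Schwarz:
  assumes holw: "w holomorphic_on ball 0 1" and bound: "\<And>z. norm z < 1 \<Longrightarrow> norm (w z) < 1"
    and w0: "w 0 = 0" and W: "w has_fps_expansion W" and r: "0 \<le> r" "r \<le> 1/4"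
  shows "majorant N r W \<le> r"
proof -
  obtain v where holv: "v holomorphic_on ball 0 1" and v: "\<And>z. norm z < 1 \<Longrightarrow> w z = z * v z"
    and dv: "deriv w 0 = v 0"
    using Schwarz3 [OF holw w0] by blast
  note Schwarz = Schwarz_Lemma [OF holw w0 bound]
  have v1: "norm (v z) \<le> 1" if "norm z < 1" for z
  proof (cases "z = 0")
    case True
    then show ?thesis using Schwarz(2) [of 0] dv by simp
  next
    case False
    then show ?thesis using Schwarz(1) [OF _ that] v [OF that] by (simp add: norm_mult)
  qed
  define V where "V = fps_expansion v 0"
  have V: "v has_fps_expansion V"
    unfolding V_def using holv by (intro has_fps_expansion_fps_expansion [of "ball 0 1"]) auto
  have 1: "(\<lambda>z. z * v z) has_fps_expansion fps_X * V"
    by (intro fps_expansion_intros V)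
  have 2: "eventually (\<lambda>z. z * v z = w z) (nhds 0)"
    using eventually_nhds_in_open [of "ball 0 1" "0::complex"] by (auto simp: v elim: eventually_mono)
  have "w has_fps_expansion fps_X * V"
    using 1 has_fps_expansion_cong [OF 2 refl] by (rule iffD1 [rotated])
  then have "W = fps_X * V" by (rule fps_expansion_unique_complex [OF W])
  then have "majorant N r W \<le> majorant N r fps_X * majorant N r V"
    using majorant_mult [OF r(1)] by simp
  also have "\<dots> \<le> r * 1"
    using r by (intro mult_mono majorant_fps_X Bohr_inequality [OF holv v1 V] majorant_nonneg) auto
  finally show ?thesis by simp
qed

text \<open>The difference of \<open>S\<close> and the polynomial is nondecreasing on
  \<open>[0, r]\<close>. This carries majorant estimates for derivatives over to the functions
  themselves.\<close>

lemma sum_power_le_of_derivative_le: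
  fixes a :: "nat \<Rightarrow> real" and S S' :: "real \<Rightarrow> real"
  assumes "0 \<le> r"
    and deriv: "\<And>t. 0 \<le> t \<Longrightarrow> t \<le> r \<Longrightarrow> (S has_real_derivative S' t) (at t)"
    and le: "\<And>t. 0 \<le> t \<Longrightarrow> t \<le> r \<Longrightarrow> (\<Sum>n\<le>N. real (Suc n) * a (Suc n) * t ^ n) \<le> S' t"
  shows "(\<Sum>n\<le>N. a (Suc n) * r ^ Suc n) \<le> S r - S 0"
proof -
  let ?f = "\<lambda>t. S t - (\<Sum>n\<le>N. a (Suc n) * t ^ Suc n)"
  have "?f 0 \<le> ?f r"
  proof (rule DERIV_nonneg_imp_nondecreasing [OF assms(1)])
    fix t assume t: "0 \<le> t" "t \<le> r"
    have "(?f has_real_derivative S' t - (\<Sum>n\<le>N. real (Suc n) * a (Suc n) * t ^ n)) (at t)"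
      by (rule derivative_eq_intros deriv t refl | simp add: mult_ac)+
    then show "\<exists>y. (?f has_real_derivative y) (at t) \<and> 0 \<le> y"
      using le [OF t] by auto
  qed
  then show ?thesis by simp
qed

subsection \<open>Power maps onto sectors\<close>

text \<open>This is \<open>((1 + c z) / (1 - z)) powr \<alpha>\<close>. The logarithms are kept
  apart because, for \<open>norm c = 1\<close>, each is taken of a number with positive real part,
  so the principal branch is holomorphic on the disc. For \<open>c = -1\<close> the map is the
  constant 1.\<close>

definition sector_map :: "complex \<Rightarrow> real \<Rightarrow> complex \<Rightarrow> complex" where
  "sector_map c \<alpha> z = exp (of_real \<alpha> * (Ln (1 + c * z) - Ln (1 - z)))"

lemma Re_one_plus_pos:
  assumes "norm c = 1" "norm z < 1"
  shows "0 < Re (1 + c * z)"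
proof -
  have "\<bar>Re (c * z)\<bar> < 1"
    using abs_Re_le_cmod [of "c * z"] assms by (simp add: norm_mult)
  then show ?thesis by simp
qed

lemma not_in_nonpos_Reals: "0 < Re z \<Longrightarrow> z \<notin> \<real>\<^sub>\<le>\<^sub>0"
  by (auto simp: complex_nonpos_Reals_iff)

text \<open>Absorbing \<open>1 / ((1 + c z) (1 - z))\<close> into the exponential exhibits the
  derivative as a constant times the exponential of an explicit power series, the form in which its
  coefficients are estimated.\<close>

lemma sector_map_has_field_derivative:
  assumes "norm c = 1" "norm z < 1"
  shows "(sector_map c \<alpha> has_field_derivative
           of_real \<alpha> * (1 + c) * exp (of_real (\<alpha> - 1) * Ln (1 + c * z) - of_real (\<alpha> + 1) * Ln (1 - z))) (at z)"
proof -
  have p: "1 + c * z \<notin> \<real>\<^sub>\<le>\<^sub>0" "1 - z \<notin> \<real>\<^sub>\<le>\<^sub>0"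
    using Re_one_plus_pos [OF assms] Re_one_plus_pos [of "-1" z] assms
    by (auto intro!: not_in_nonpos_Reals)
  then have nz: "1 + c * z \<noteq> 0" "1 - z \<noteq> 0" by auto
  have "(sector_map c \<alpha> has_field_derivative
          sector_map c \<alpha> z * (of_real \<alpha> * (c / (1 + c * z) - (- 1) / (1 - z)))) (at z)"
    unfolding sector_map_def using p
    by (auto intro!: derivative_eq_intros simp: divide_inverse)
  also have "c / (1 + c * z) - (- 1) / (1 - z) = (1 + c) / ((1 + c * z) * (1 - z))"
    using nz by (simp add: field_simps)
  also have "\<dots> = (1 + c) * exp (- Ln (1 + c * z) - Ln (1 - z))"
    using nz by (simp add: exp_diff exp_minus divide_inverse mult.assoc)
  also have "sector_map c \<alpha> z * (of_real \<alpha> * \<dots>) =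
      of_real \<alpha> * (1 + c) * (sector_map c \<alpha> z * exp (- Ln (1 + c * z) - Ln (1 - z)))"
    by simp
  also have "sector_map c \<alpha> z * exp (- Ln (1 + c * z) - Ln (1 - z)) =
      exp (of_real (\<alpha> - 1) * Ln (1 + c * z) - of_real (\<alpha> + 1) * Ln (1 - z))"
    unfolding sector_map_def by (simp flip: exp_add) (simp add: algebra_simps)
  finally show ?thesis .
qed

lemma sector_map_holomorphic:
  assumes "norm c = 1"
  shows "sector_map c \<alpha> holomorphic_on ball 0 1"
proof (rule holomorphic_onI)
  fix z :: complex assume "z \<in> ball 0 1"
  then have "norm z < 1" by simp
  from sector_map_has_field_derivative [OF assms this, of \<alpha>]
  show "sector_map c \<alpha> field_differentiable at z within ball 0 1"
    unfolding field_differentiable_def by (blast intro: has_field_derivative_at_within)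
qed

lemma sector_map_0: "sector_map c \<alpha> 0 = 1"
  by (simp add: sector_map_def)

lemma sector_map_of_real:
  fixes r :: real
  assumes "0 \<le> r" "r < 1"
  shows "sector_map 1 \<alpha> (of_real r) = of_real (((1 + r) / (1 - r)) powr \<alpha>)"
proof -
  have "Ln (1 + of_real r) = of_real (ln (1 + r))" "Ln (1 - of_real r) = of_real (ln (1 - r))"
    using assms Ln_of_real [of "1 + r"] Ln_of_real [of "1 - r"] by auto
  then have "sector_map 1 \<alpha> (of_real r) = exp (of_real (\<alpha> * (ln (1 + r) - ln (1 - r))))"
    by (simp add: sector_map_def)
  also have "\<dots> = of_real (exp (\<alpha> * (ln (1 + r) - ln (1 - r))))"
    by (rule exp_of_real)
  also have "\<alpha> * (ln (1 + r) - ln (1 - r)) = \<alpha> * ln ((1 + r) / (1 - r))"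
    using assms by (simp add: ln_div)
  finally show ?thesis using assms by (simp add: powr_def)
qed

text \<open>Two logarithm series are combined; the term \<open>n = 0\<close> is 0 because division
  by 0 yields 0.\<close>

lemma log_sector_map_sums:
  assumes "norm c = 1" "norm z < 1"
  shows "(\<lambda>n. (of_real (\<alpha> + 1) - of_real (\<alpha> - 1) * (- c) ^ n) / of_nat n * z ^ n) sums
           (of_real (\<alpha> - 1) * Ln (1 + c * z) - of_real (\<alpha> + 1) * Ln (1 - z))"
proof -
  have "(\<lambda>n. - ((- (c * z)) ^ n) / of_nat n) sums Ln (1 + c * z)"
    using Ln_series' [of "c * z"] assms by (simp add: norm_mult)
  moreover have "(\<lambda>n. - ((- (- z)) ^ n) / of_nat n) sums Ln (1 + - z)"
    using assms by (intro Ln_series') simp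
  ultimately have "(\<lambda>n. of_real (\<alpha> - 1) * (- ((- (c * z)) ^ n) / of_nat n) -
          of_real (\<alpha> + 1) * (- ((- (- z)) ^ n) / of_nat n)) sums
        (of_real (\<alpha> - 1) * Ln (1 + c * z) - of_real (\<alpha> + 1) * Ln (1 + - z))"
    by (intro sums_diff sums_mult)
  moreover have "of_real (\<alpha> - 1) * (- ((- (c * z)) ^ n) / of_nat n) -
          of_real (\<alpha> + 1) * (- ((- (- z)) ^ n) / of_nat n) =
      (of_real (\<alpha> + 1) - of_real (\<alpha> - 1) * (- c) ^ n) / of_nat n * z ^ n" for n
  proof -
    have "(- (c * z)) ^ n = (- c) ^ n * z ^ n" by (simp flip: power_mult_distrib)
    then show ?thesis by (simp add: field_simps diff_divide_distrib add_divide_distrib)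
  qed
  ultimately show ?thesis by simp
qed

section \<open>Coefficient bounds for sector maps and their derivatives\<close>

lemma norm_one_minus_power_le:
  fixes c :: complex
  assumes "norm c = 1"
  shows "norm (1 - c ^ n) \<le> real n * norm (1 - c)"
proof (induction n)
  case (Suc n)
  have "1 - c ^ Suc n = (1 - c) + c * (1 - c ^ n)" by (simp add: algebra_simps)
  also have "norm \<dots> \<le> norm (1 - c) + norm (1 - c ^ n)"
    by (rule norm_triangle_le) (simp add: norm_mult assms)
  finally show ?case using Suc by (simp add: algebra_simps)
qed simp

lemma norm_one_minus_unit_power2:
  fixes u :: complex
  assumes "norm u = 1"
  shows "(norm (1 - u))\<^sup>2 = 2 * (1 - Re u)"
proof -
  have "(Re u)\<^sup>2 + (Im u)\<^sup>2 = 1" using assms by (simp add: cmod_def)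
  then show ?thesis unfolding cmod_power2 by (simp add: power2_eq_square algebra_simps)
qed

text \<open>
  For even \<open>n\<close> this modulus is not maximal at \<open>c = 1\<close>, where it is \<open>2\<close>, but the excess is of second
  order in \<open>1 - c\<close>, since \<open>1 - c ^ n\<close> is purely imaginary to first order.
\<close>

lemma norm_log_sector_map_coeff_le:
  fixes c :: complex
  assumes c: "norm c = 1" and \<alpha>: "1 \<le> \<alpha>" "\<alpha> \<le> 2"
  shows "norm (of_real (\<alpha> + 1) - of_real (\<alpha> - 1) * (- c) ^ n) \<le>
           (\<alpha> + 1 - (\<alpha> - 1) * (- 1) ^ n) + (if even n then 3 * (real n)\<^sup>2 * ((1 - Re c) / 2) else 0)"
proof (cases "even n")
  case False
  have "norm (of_real (\<alpha> + 1) - of_real (\<alpha> - 1) * (- c) ^ n) \<le> \<bar>\<alpha> + 1\<bar> + \<bar>\<alpha> - 1\<bar>"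
    using c by (intro norm_triangle_le_diff) (simp add: norm_mult norm_power flip: of_real_add of_real_diff)
  then show ?thesis using False \<alpha> by simp
next
  case True
  define u where "u = c ^ n"
  have u: "norm u = 1" using c by (simp add: u_def norm_power)
  define X where "X = norm (of_real (\<alpha> + 1) - of_real (\<alpha> - 1) * u)"
  have u2: "(Re u)\<^sup>2 + (Im u)\<^sup>2 = 1" using u by (simp add: cmod_def)
  have X2: "X\<^sup>2 = 4 + 2 * (\<alpha> - 1) * (\<alpha> + 1) * (1 - Re u)"
  proof -
    have "X\<^sup>2 = (\<alpha> + 1 - (\<alpha> - 1) * Re u)\<^sup>2 + ((\<alpha> - 1) * Im u)\<^sup>2"
      by (simp add: X_def cmod_power2)
    also have "\<dots> = (\<alpha> + 1)\<^sup>2 - 2 * (\<alpha> + 1) * (\<alpha> - 1) * Re u + (\<alpha> - 1)\<^sup>2 * ((Re u)\<^sup>2 + (Im u)\<^sup>2)"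
      by (simp add: power2_eq_square algebra_simps)
    finally show ?thesis unfolding u2 by (simp add: power2_eq_square algebra_simps)
  qed
  have "2 * (1 - Re u) \<le> (real n)\<^sup>2 * (2 * (1 - Re c))"
    using power_mono [OF norm_one_minus_power_le [OF c, of n], of 2]
    by (simp add: power_mult_distrib norm_one_minus_unit_power2 [OF c]
        norm_one_minus_unit_power2 [OF u, unfolded u_def] u_def del: mult_le_cancel_left_pos)
  then have Re_le: "1 - Re u \<le> (real n)\<^sup>2 * (1 - Re c)" by (simp add: algebra_simps)
  have "(\<alpha> - 1) * (\<alpha> + 1) \<le> 1 * 3" using \<alpha> by (intro mult_mono) auto
  moreover have "0 \<le> 1 - Re u" using u abs_Re_le_cmod [of u] by simp
  ultimately have "(\<alpha> - 1) * (\<alpha> + 1) * (1 - Re u) \<le> 3 * (1 - Re u)"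
    by (intro mult_right_mono) auto
  then have "X\<^sup>2 \<le> 4 + 6 * (1 - Re u)"
    unfolding X2 by linarith
  \<comment> \<open>Expanding \<open>(X - 2)^2 \<ge> 0\<close> linearizes at \<open>X = 2\<close>,
    the value for \<open>c = 1\<close>, and avoids a square root.\<close>
  moreover have "4 * X \<le> X\<^sup>2 + 4"
    using zero_le_power2 [of "X - 2"] by (simp add: power2_eq_square algebra_simps)
  moreover have "6 * (1 - Re u) \<le> 6 * ((real n)\<^sup>2 * (1 - Re c))"
    using Re_le by simp
  ultimately have "4 * X \<le> 8 + 6 * ((real n)\<^sup>2 * (1 - Re c))"
    by linarith
  then have "X \<le> 2 + 3 * (real n)\<^sup>2 * ((1 - Re c) / 2)"
    by (simp add: field_simps)
  then show ?thesis using True by (simp add: X_def u_def)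
qed

lemma sum_arith_geometric:
  "(\<Sum>n\<le>N. real n * (1/5) ^ n) = 5/16 - (4 * real N + 5) / (16 * 5 ^ N)"
proof (induction N)
  case (Suc N)
  have "(\<Sum>n\<le>Suc N. real n * (1/5::real) ^ n) =
      5/16 - (4 * real N + 5) / (16 * 5 ^ N) + (real N + 1) / (5 * 5 ^ N)"
    unfolding sum.atMost_Suc Suc by (simp add: power_divide)
  also have "\<dots> = 5/16 - (4 * real (Suc N) + 5) / (16 * 5 ^ Suc N)"
    by (simp add: divide_simps)
  finally show ?case .
qed simp

text \<open>It is enough to drop the term \<open>n = 1\<close> from the sum of
  \<open>n / 5^n\<close>, which is at most \<open>5/16\<close>: \<open>5/16 - 1/5 = 9/80\<close>.
  With the bound \<open>1/6\<close> an excess of \<open>3 * \<delta>\<close> per unit becomes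
  \<open>\<delta> / 2\<close>, which the factor \<open>norm (1 + c)\<close> can compensate.\<close>

lemma sum_even_le:
  assumes "0 \<le> r" "r \<le> 1/5"
  shows "(\<Sum>n\<le>N. (if even n then real n else 0) * r ^ n) \<le> 1/6"
proof -
  have "(\<Sum>n\<le>N. (if even n then real n else 0) * r ^ n) \<le>
      (\<Sum>n\<le>N. real n * (1/5) ^ n - (if n = 1 then 1/5 else 0))"
  proof (rule sum_mono)
    fix n
    have "r ^ n \<le> (1/5) ^ n" using assms by (intro power_mono) auto
    then show "(if even n then real n else 0) * r ^ n \<le> real n * (1/5) ^ n - (if n = 1 then 1/5 else 0)"
      by (auto intro!: mult_left_mono)
  qed
  also have "\<dots> \<le> 1/6"
  proof (cases "N = 0")
    case False
    have "(\<Sum>n\<le>N. real n * (1/5) ^ n - (if n = 1 then 1/5 else 0)) \<le> 5/16 - 1/5"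
      using False unfolding sum_subtractf sum_arith_geometric
      by (simp add: sum.delta)
    then show ?thesis by simp
  qed simp
  finally show ?thesis .
qed

text \<open>With \<open>\<delta> = (1 - Re c) / 2\<close> the modulus is
  \<open>2 * sqrt (1 - \<delta>)\<close>, and
  \<open>1 - \<delta> \<le> exp (- \<delta>)\<close>.\<close>

lemma norm_one_plus_unit_le:
  assumes "norm c = 1"
  shows "norm (1 + c) \<le> 2 * exp (- ((1 - Re c) / 4))"
proof -
  have "(norm (1 + c))\<^sup>2 = 4 * (1 - (1 - Re c) / 2)"
    using norm_one_minus_unit_power2 [of "- c"] assms by (simp add: field_simps)
  also have "\<dots> \<le> 4 * exp (- ((1 - Re c) / 2))"
    using exp_ge_add_one_self [of "- ((1 - Re c) / 2)"] by (intro mult_left_mono) auto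
  also have "\<dots> = (2 * exp (- ((1 - Re c) / 4)))\<^sup>2"
    by (simp add: power_mult_distrib flip: exp_of_nat_mult)
  finally show ?thesis by (rule power2_le_imp_le) simp
qed

lemma log_sector_map_real_sums:
  assumes "0 \<le> r" "r < 1"
  shows "(\<lambda>n. (\<alpha> + 1 - (\<alpha> - 1) * (- 1) ^ n) / real n * r ^ n) sums
           ((\<alpha> - 1) * ln (1 + r) - (\<alpha> + 1) * ln (1 - r))"
proof -
  have "(\<lambda>n. complex_of_real ((\<alpha> + 1 - (\<alpha> - 1) * (- 1) ^ n) / real n * r ^ n)) sums
          (of_real (\<alpha> - 1) * Ln (1 + 1 * of_real r) - of_real (\<alpha> + 1) * Ln (1 - of_real r))"
    using log_sector_map_sums [of 1 "of_real r" \<alpha>] assms by simp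
  also have "of_real (\<alpha> - 1) * Ln (1 + 1 * of_real r) - of_real (\<alpha> + 1) * Ln (1 - of_real r) =
      complex_of_real ((\<alpha> - 1) * ln (1 + r) - (\<alpha> + 1) * ln (1 - r))"
    using assms Ln_of_real [of "1 + r"] Ln_of_real [of "1 - r"] by simp
  finally show ?thesis by (simp only: sums_of_real_iff)
qed

text \<open>The coefficients of the exponential are positive, so the bound for a composition is a
  partial sum of the exponential series at \<open>majorant N r L\<close>.\<close>

lemma majorant_exp_compose:
  assumes "0 \<le> r" "fps_nth L 0 = 0"
  shows "majorant N r (fps_exp 1 oo L) \<le> exp (majorant N r L)"
proof -
  have "majorant N r (fps_exp 1 oo L) \<le> (\<Sum>k\<le>N. inverse (fact k) * majorant N r L ^ k)"
    using majorant_compose [OF assms, of N "fps_exp 1"] by (simp add: norm_divide divide_inverse norm_inverse)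
  also have "\<dots> \<le> (\<Sum>k. inverse (fact k) * majorant N r L ^ k)"
    using majorant_nonneg [OF assms(1)]
    by (intro sum_le_suminf summable_exp) auto
  also have "\<dots> = exp (majorant N r L)"
    by (simp add: exp_def divide_inverse)
  finally show ?thesis .
qed

text \<open>The majorant of the exponent \<open>L\<close> exceeds its value \<open>M\<close> for
  \<open>c = 1\<close> by at most \<open>\<delta> / 2\<close>, where
  \<open>\<delta> = (1 - Re c) / 2\<close>. The factor
  \<open>norm (1 + c) \<le> 2 * exp (- (\<delta> / 2))\<close> cancels this excess, so the bound is
  independent of \<open>c\<close>; it is the derivative of
  \<open>((1 + r) / (1 - r)) powr \<alpha>\<close>.\<close>

lemma majorant_deriv_sector_map:
  assumes c: "norm c = 1" and \<alpha>: "1 \<le> \<alpha>" "\<alpha> \<le> 2" and P: "sector_map c \<alpha> has_fps_expansion P"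
    and r: "0 \<le> r" "r \<le> 1/5"
  shows "majorant N r (fps_deriv P) \<le> 2 * \<alpha> * exp ((\<alpha> - 1) * ln (1 + r) - (\<alpha> + 1) * ln (1 - r))"
proof -
  define l where "l z = of_real (\<alpha> - 1) * Ln (1 + c * z) - of_real (\<alpha> + 1) * Ln (1 - z)" for z
  define L where "L = Abs_fps (\<lambda>n. (of_real (\<alpha> + 1) - of_real (\<alpha> - 1) * (- c) ^ n) / of_nat n)"
  have L: "l has_fps_expansion L"
  proof (rule has_fps_expansionI, rule eventually_mono [OF eventually_nhds_in_open [of "ball 0 1"]])
    fix z :: complex assume "z \<in> ball 0 1"
    then show "(\<lambda>n. fps_nth L n * z ^ n) sums l z"
      using log_sector_map_sums [OF c, of z \<alpha>] by (simp add: L_def l_def)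
  qed auto
  have L0: "fps_nth L 0 = 0" by (simp add: L_def)
  have 1: "(\<lambda>z. of_real \<alpha> * (1 + c) * (exp \<circ> l) z) has_fps_expansion
      fps_const (of_real \<alpha> * (1 + c)) * (fps_exp 1 oo L)"
    using L L0 by (intro fps_expansion_intros)
  have "eventually (\<lambda>z. of_real \<alpha> * (1 + c) * (exp \<circ> l) z = deriv (sector_map c \<alpha>) z) (nhds 0)"
  proof (rule eventually_mono [OF eventually_nhds_in_open [of "ball 0 1"]])
    fix z :: complex assume "z \<in> ball 0 1"
    then show "of_real \<alpha> * (1 + c) * (exp \<circ> l) z = deriv (sector_map c \<alpha>) z"
      using DERIV_imp_deriv [OF sector_map_has_field_derivative [OF c, of z \<alpha>]] by (simp add: l_def)
  qed auto
  from has_fps_expansion_cong [OF this refl] 1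
  have "deriv (sector_map c \<alpha>) has_fps_expansion fps_const (of_real \<alpha> * (1 + c)) * (fps_exp 1 oo L)"
    by (rule iffD1)
  with has_fps_expansion_deriv [OF P]
  have eq: "fps_deriv P = fps_const (of_real \<alpha> * (1 + c)) * (fps_exp 1 oo L)"
    by (rule fps_expansion_unique_complex)
  define \<delta> where "\<delta> = (1 - Re c) / 2"
  have \<delta>: "0 \<le> \<delta>" using abs_Re_le_cmod [of c] c by (simp add: \<delta>_def)
  define M where "M = (\<alpha> - 1) * ln (1 + r) - (\<alpha> + 1) * ln (1 - r)"
  \<comment> \<open>The first summand belongs to the series for \<open>c = 1\<close> at the point
    \<open>r\<close>; the second is the excess of the even coefficients, of size
    \<open>n^2 / n = n\<close>.\<close>
  have "majorant N r L \<le> (\<Sum>n\<le>N. (\<alpha> + 1 - (\<alpha> - 1) * (- 1) ^ n) / real n * r ^ n +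
      3 * \<delta> * ((if even n then real n else 0) * r ^ n))"
    unfolding majorant_def
  proof (rule sum_mono)
    fix n
    have "norm (fps_nth L n) = norm (of_real (\<alpha> + 1) - of_real (\<alpha> - 1) * (- c) ^ n) / real n"
      by (simp add: L_def norm_divide)
    also have "\<dots> \<le> ((\<alpha> + 1 - (\<alpha> - 1) * (- 1) ^ n) + (if even n then 3 * (real n)\<^sup>2 * \<delta> else 0)) / real n"
      unfolding \<delta>_def by (intro divide_right_mono norm_log_sector_map_coeff_le c \<alpha>) auto
    also have "\<dots> = (\<alpha> + 1 - (\<alpha> - 1) * (- 1) ^ n) / real n + 3 * \<delta> * (if even n then real n else 0)"
      by (cases "n = 0") (auto simp: add_divide_distrib power2_eq_square)
    finally show "norm (fps_nth L n) * r ^ n \<le> (\<alpha> + 1 - (\<alpha> - 1) * (- 1) ^ n) / real n * r ^ n +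
      3 * \<delta> * ((if even n then real n else 0) * r ^ n)"
      using r mult_right_mono [of "norm (fps_nth L n)" _ "r ^ n"]
      unfolding distrib_right [symmetric] mult.assoc [of "3 * \<delta>", symmetric] by auto
  qed
  also have "\<dots> = (\<Sum>n\<le>N. (\<alpha> + 1 - (\<alpha> - 1) * (- 1) ^ n) / real n * r ^ n) +
      3 * \<delta> * (\<Sum>n\<le>N. (if even n then real n else 0) * r ^ n)"
    by (simp only: sum.distrib sum_distrib_left)
  also have "\<dots> \<le> M + 3 * \<delta> * (1/6)"
  proof (intro add_mono mult_left_mono sum_even_le r)
    have sums: "(\<lambda>n. (\<alpha> + 1 - (\<alpha> - 1) * (- 1) ^ n) / real n * r ^ n) sums M"
      unfolding M_def using r by (intro log_sector_map_real_sums) auto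
    have "0 \<le> \<alpha> + 1 - (\<alpha> - 1) * (- 1) ^ n" for n
      using \<alpha> by (cases "even n") auto
    then show "(\<Sum>n\<le>N. (\<alpha> + 1 - (\<alpha> - 1) * (- 1) ^ n) / real n * r ^ n) \<le> M"
      unfolding sums_unique [OF sums] using r
      by (intro sum_le_suminf sums_summable [OF sums]) auto
  qed (use \<delta> in auto)
  finally have "exp (majorant N r L) \<le> exp (M + \<delta> / 2)" by simp
  with majorant_exp_compose [OF r(1) L0, of N]
  have le: "majorant N r (fps_exp 1 oo L) \<le> exp (M + \<delta> / 2)" by linarith
  have "majorant N r (fps_deriv P) \<le> (\<alpha> * norm (1 + c)) * majorant N r (fps_exp 1 oo L)"
    unfolding eq using majorant_mult [OF r(1), of N "fps_const (of_real \<alpha> * (1 + c))"] \<alpha>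
    by (simp add: majorant_const norm_mult)
  also have "\<dots> \<le> (\<alpha> * (2 * exp (- (\<delta> / 2)))) * exp (M + \<delta> / 2)"
    using norm_one_plus_unit_le [OF c] \<alpha> le
    by (intro mult_mono mult_left_mono majorant_nonneg r) (auto simp: \<delta>_def)
  also have "\<dots> = 2 * \<alpha> * exp M"
    using exp_add [of "- (\<delta> / 2)" "M + \<delta> / 2"] by simp
  finally show ?thesis by (simp add: M_def)
qed

text \<open>The derivative bound is integrated from 0 to \<open>r\<close>; \<open>S\<close> is the
  power of the quotient written with logarithms, and \<open>S'\<close> its derivative.\<close>

lemma sum_sector_map_coeffs_le:
  assumes c: "norm c = 1" and \<alpha>: "1 \<le> \<alpha>" "\<alpha> \<le> 2" and P: "sector_map c \<alpha> has_fps_expansion P"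
    and r: "0 \<le> r" "r \<le> 1/5"
  shows "(\<Sum>n\<le>N. norm (fps_nth P (Suc n)) * r ^ Suc n) \<le> ((1 + r) / (1 - r)) powr \<alpha> - 1"
proof -
  define S where "S t = exp (\<alpha> * (ln (1 + t) - ln (1 - t)))" for t :: real
  define S' where "S' t = 2 * \<alpha> * exp ((\<alpha> - 1) * ln (1 + t) - (\<alpha> + 1) * ln (1 - t))" for t :: real
  have "(\<Sum>n\<le>N. norm (fps_nth P (Suc n)) * r ^ Suc n) \<le> S r - S 0"
  proof (rule sum_power_le_of_derivative_le [where a = "\<lambda>n. norm (fps_nth P n)" and S' = S'])
    fix t assume t: "0 \<le> t" "t \<le> r"
    then have t1: "t < 1" using r by simp
    have "(S has_real_derivative S t * (\<alpha> * (1 / (1 + t) - (- 1) / (1 - t)))) (at t)"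
      unfolding S_def using t t1 by (auto intro!: derivative_eq_intros simp: divide_inverse)
    also have "1 / (1 + t) - (- 1) / (1 - t) = 2 * exp (- ln (1 + t) - ln (1 - t))"
      using t t1 by (simp add: exp_diff exp_minus field_simps)
    also have "S t * (\<alpha> * (2 * exp (- ln (1 + t) - ln (1 - t)))) =
        2 * \<alpha> * (S t * exp (- ln (1 + t) - ln (1 - t)))" by simp
    also have "S t * exp (- ln (1 + t) - ln (1 - t)) = exp ((\<alpha> - 1) * ln (1 + t) - (\<alpha> + 1) * ln (1 - t))"
      unfolding S_def by (simp flip: exp_add) (simp add: algebra_simps)
    finally show "(S has_real_derivative S' t) (at t)" by (simp add: S'_def)
    show "(\<Sum>n\<le>N. real (Suc n) * norm (fps_nth P (Suc n)) * t ^ n) \<le> S' t"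
      using majorant_deriv_sector_map [OF c \<alpha> P, of t N] t r
      by (simp add: majorant_def S'_def norm_mult del: of_nat_Suc)
  qed (use r in auto)
  also have "S r - S 0 = ((1 + r) / (1 - r)) powr \<alpha> - 1"
    using r by (simp add: S_def powr_def ln_div)
  finally show ?thesis .
qed

text \<open>In a composition with a Schwarz function the majorant of \<open>w\<close> replaces
  \<open>r\<close>, and \<open>majorant_Schwarz\<close> bounds it by \<open>r\<close> again.\<close>

lemma sum_subordinate_sector_map_coeffs_le:
  assumes c: "norm c = 1" and \<alpha>: "1 \<le> \<alpha>" "\<alpha> \<le> 2"
    and holw: "w holomorphic_on ball 0 1" and bound: "\<And>z. norm z < 1 \<Longrightarrow> norm (w z) < 1"
    and w0: "w 0 = 0"
    and F: "f has_fps_expansion F" and f: "\<And>z. norm z < 1 \<Longrightarrow> f z = sector_map c \<alpha> (w z)"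
    and r: "0 \<le> r" "r \<le> 1/5"
  shows "(\<Sum>n\<le>N. norm (fps_nth F (Suc n)) * r ^ Suc n) \<le> ((1 + r) / (1 - r)) powr \<alpha> - 1"
proof -
  define W where "W = fps_expansion w 0"
  have W: "w has_fps_expansion W"
    unfolding W_def using holw by (intro has_fps_expansion_fps_expansion [of "ball 0 1"]) auto
  have W0: "fps_nth W 0 = 0"
    using has_fps_expansion_imp_0_eq_fps_nth_0 [OF W] w0 by simp
  define P where "P = fps_expansion (sector_map c \<alpha>) 0"
  have P: "sector_map c \<alpha> has_fps_expansion P"
    unfolding P_def using sector_map_holomorphic [OF c]
    by (intro has_fps_expansion_fps_expansion [of "ball 0 1"]) auto
  have "eventually (\<lambda>z. f z = (sector_map c \<alpha> \<circ> w) z) (nhds 0)"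
    using eventually_nhds_in_open [of "ball 0 1" "0::complex"] by (auto simp: f elim: eventually_mono)
  from has_fps_expansion_cong [OF this refl] F have "(sector_map c \<alpha> \<circ> w) has_fps_expansion F"
    by (rule iffD1)
  then have FP: "F = P oo W"
    using has_fps_expansion_compose [OF P W W0] by (rule fps_expansion_unique_complex)
  \<comment> \<open>Removing the constant term of \<open>P\<close> removes exactly that of
    \<open>F\<close>, so full majorants of \<open>Q\<close> and \<open>Q oo W\<close> are the sums
    starting at degree 1.\<close>
  define Q where "Q = P - fps_const (fps_nth P 0)"
  have "(\<Sum>n\<le>N. norm (fps_nth F (Suc n)) * r ^ Suc n) = majorant (Suc N) r (Q oo W)"
    unfolding majorant_def sum.atMost_Suc_shift by (simp add: Q_def FP fps_compose_sub_distrib)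
  also have "\<dots> \<le> (\<Sum>k\<le>Suc N. norm (fps_nth Q k) * majorant (Suc N) r W ^ k)"
    using r W0 by (intro majorant_compose) auto
  also have "\<dots> \<le> (\<Sum>k\<le>Suc N. norm (fps_nth Q k) * r ^ k)"
    using r majorant_Schwarz [OF holw bound w0 W, of r "Suc N"] majorant_nonneg [OF r(1)]
    by (intro sum_mono mult_left_mono power_mono) auto
  also have "\<dots> = (\<Sum>k\<le>N. norm (fps_nth P (Suc k)) * r ^ Suc k)"
    unfolding sum.atMost_Suc_shift by (simp add: Q_def)
  also have "\<dots> \<le> ((1 + r) / (1 - r)) powr \<alpha> - 1"
    by (rule sum_sector_map_coeffs_le [OF c \<alpha> P r])
  finally show ?thesis .
qed

text \<open>The relation \<open>g' = \<omega> h'\<close> and submultiplicativity reduce the claim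
  for derivatives to Bohr's inequality for \<open>\<omega>\<close>; the result is then
  integrated.\<close>

lemma sum_dilatation_coeffs_le:
  assumes h: "h holomorphic_on ball 0 1" and g: "g holomorphic_on ball 0 1"
    and H: "h has_fps_expansion H" and G: "g has_fps_expansion G"
    and h': "\<And>z. norm z < 1 \<Longrightarrow> deriv h z \<noteq> 0"
    and le: "\<And>z. norm z < 1 \<Longrightarrow> norm (deriv g z / deriv h z) \<le> k"
    and r: "0 \<le> r" "r \<le> 1/4"
  shows "(\<Sum>n\<le>N. norm (fps_nth G (Suc n)) * r ^ Suc n) \<le> k * (\<Sum>n\<le>N. norm (fps_nth H (Suc n)) * r ^ Suc n)"
proof -
  define \<omega> where "\<omega> z = deriv g z / deriv h z" for z
  have hol: "\<omega> holomorphic_on ball 0 1"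
    unfolding \<omega>_def using h' by (intro holomorphic_intros h g) auto
  define V where "V = fps_expansion \<omega> 0"
  have V: "\<omega> has_fps_expansion V"
    unfolding V_def using hol by (intro has_fps_expansion_fps_expansion [of "ball 0 1"]) auto
  have 1: "(\<lambda>z. \<omega> z * deriv h z) has_fps_expansion V * fps_deriv H"
    by (intro fps_expansion_intros V H)
  have "eventually (\<lambda>z. \<omega> z * deriv h z = deriv g z) (nhds 0)"
    using eventually_nhds_in_open [of "ball 0 1" "0::complex"]
    by (auto simp: \<omega>_def h' elim: eventually_mono)
  from has_fps_expansion_cong [OF this refl] 1 have "deriv g has_fps_expansion V * fps_deriv H"
    by (rule iffD1)
  with has_fps_expansion_deriv [OF G] have eq: "fps_deriv G = V * fps_deriv H"
    by (rule fps_expansion_unique_complex)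
  let ?S = "\<lambda>t. k * (\<Sum>n\<le>N. norm (fps_nth H (Suc n)) * t ^ Suc n)"
  have "(\<Sum>n\<le>N. norm (fps_nth G (Suc n)) * r ^ Suc n) \<le> ?S r - ?S 0"
  proof (rule sum_power_le_of_derivative_le [where a = "\<lambda>n. norm (fps_nth G n)" and
        S' = "\<lambda>t. k * (\<Sum>n\<le>N. real (Suc n) * norm (fps_nth H (Suc n)) * t ^ n)"])
    fix t assume t: "0 \<le> t" "t \<le> r"
    show "(?S has_real_derivative k * (\<Sum>n\<le>N. real (Suc n) * norm (fps_nth H (Suc n)) * t ^ n)) (at t)"
      by (rule derivative_eq_intros refl | simp add: mult_ac)+
    have "majorant N t (fps_deriv G) \<le> majorant N t V * majorant N t (fps_deriv H)"
      unfolding eq by (rule majorant_mult [OF t(1)])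
    also have "\<dots> \<le> k * majorant N t (fps_deriv H)"
      using t r le by (intro mult_right_mono Bohr_inequality [OF hol _ V] majorant_nonneg) (auto simp: \<omega>_def)
    finally show "(\<Sum>n\<le>N. real (Suc n) * norm (fps_nth G (Suc n)) * t ^ n) \<le>
        k * (\<Sum>n\<le>N. real (Suc n) * norm (fps_nth H (Suc n)) * t ^ n)"
      by (simp add: majorant_def norm_mult del: of_nat_Suc)
  qed (use r in auto)
  then show ?thesis by simp
qed

text \<open>
  A logarithm with values in a strip of width at most \<open>\<pi> \<alpha>\<close>, divided by \<open>\<alpha>\<close> and exponentiated, has
  values in a half-plane bounded by a line through \<open>0\<close>; the Moebius map \<open>(q - 1) / (q + c)\<close>
  takes this half-plane to the disc, where \<open>- c\<close> is the reflection of \<open>1\<close> in that line.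
\<close>

lemma strip_imp_subordinate_sector_map:
  assumes holL: "L holomorphic_on ball 0 1" and L0: "L 0 = 0" and \<alpha>: "0 < \<alpha>"
    and strip: "\<And>z. norm z < 1 \<Longrightarrow> A < Im (L z) \<and> Im (L z) < B" and width: "B - A \<le> pi * \<alpha>"
  obtains c w where "norm c = 1" "w holomorphic_on ball 0 1" "\<And>z. norm z < 1 \<Longrightarrow> norm (w z) < 1"
    "w 0 = 0" "\<And>z. norm z < 1 \<Longrightarrow> exp (L z) = sector_map c \<alpha> (w z)"
proof -
  \<comment> \<open>After division by \<open>\<alpha>\<close> the strip has half-width at most
    \<open>pi / 2\<close> about the height \<open>\<psi>\<close>, so \<open>q\<close> takes values
    in the half-plane with inner normal \<open>cis \<psi>\<close>.\<close>
  define \<psi> where "\<psi> = (A + B) / (2 * \<alpha>)"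
  define l where "l z = L z / of_real \<alpha>" for z
  define q where "q z = exp (l z)" for z
  define c where "c = cis (2 * \<psi>)"
  define w where "w z = (q z - 1) / (q z + c)" for z
  have c: "norm c = 1" by (simp add: c_def)
  have AB: "A < 0" "0 < B" using strip [of 0] L0 by auto
  have ang: "\<bar>Im (l z) - \<psi>\<bar> < pi / 2" if "norm z < 1" for z
  proof -
    have "\<bar>Im (L z) - (A + B) / 2\<bar> < (B - A) / 2" using strip [OF that] by (auto simp: abs_if field_simps)
    also have "\<dots> \<le> pi * \<alpha> / 2" using width by simp
    finally have "\<bar>Im (L z) - (A + B) / 2\<bar> / \<alpha> < pi * \<alpha> / 2 / \<alpha>"
      using \<alpha> by (intro divide_strict_right_mono) auto
    also have "\<bar>Im (L z) - (A + B) / 2\<bar> / \<alpha> = \<bar>(Im (L z) - (A + B) / 2) / \<alpha>\<bar>"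
      using \<alpha> by simp
    also have "(Im (L z) - (A + B) / 2) / \<alpha> = Im (l z) - \<psi>"
      using \<alpha> by (simp add: l_def \<psi>_def field_simps)
    finally show ?thesis using \<alpha> by simp
  qed
  have \<psi>: "\<bar>\<psi>\<bar> < pi / 2" using ang [of 0] L0 by (simp add: l_def)
  \<comment> \<open>Points of the half-plane are closer to 1 than to its mirror image
    \<open>- c\<close>: the difference of the squared distances is
    \<open>4 * \<rho> * cos (\<theta> - \<psi>) * cos \<psi>\<close>.\<close>
  have key: "norm (q z - 1) < norm (q z + c)" if z: "norm z < 1" for z
  proof -
    have "cos (Im (l z) - \<psi>) > 0" using ang [OF z] by (intro cos_gt_zero_pi) linarith+
    moreover have "cos \<psi> > 0" using \<psi> by (intro cos_gt_zero_pi) linarith+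
    ultimately have pos: "0 < exp (Re (l z)) * (cos (Im (l z) - \<psi>) * cos \<psi>)" by simp
    define \<rho> where "\<rho> = exp (Re (l z))"
    define \<theta> where "\<theta> = Im (l z)"
    have q: "Re (q z) = \<rho> * cos \<theta>" "Im (q z) = \<rho> * sin \<theta>"
      by (auto simp: q_def \<rho>_def \<theta>_def Re_exp Im_exp)
    have s1: "(sin \<theta>)\<^sup>2 = 1 - (cos \<theta>)\<^sup>2" "(sin (2 * \<psi>))\<^sup>2 = 1 - (cos (2 * \<psi>))\<^sup>2"
      by (simp_all add: sin_squared_eq)
    have "(norm (q z + c))\<^sup>2 - (norm (q z - 1))\<^sup>2 =
        2 * \<rho> * (cos \<theta> * cos (2 * \<psi>) + sin \<theta> * sin (2 * \<psi>) + cos \<theta>) +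
        ((cos (2 * \<psi>))\<^sup>2 + (sin (2 * \<psi>))\<^sup>2 - 1)"
      unfolding cmod_power2 by (simp add: q c_def) (simp add: power2_eq_square algebra_simps)
    also have "\<dots> = 2 * \<rho> * (cos (\<theta> - 2 * \<psi>) + cos \<theta>)"
      by (simp add: cos_diff)
    also have "cos (\<theta> - 2 * \<psi>) + cos \<theta> = 2 * cos (\<theta> - \<psi>) * cos \<psi>"
      using cos_add [of "\<theta> - \<psi>" \<psi>] cos_diff [of "\<theta> - \<psi>" \<psi>] by (simp add: algebra_simps)
    finally have "(norm (q z + c))\<^sup>2 - (norm (q z - 1))\<^sup>2 = 4 * (\<rho> * (cos (\<theta> - \<psi>) * cos \<psi>))"
      by simp
    then have "(norm (q z - 1))\<^sup>2 < (norm (q z + c))\<^sup>2"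
      using pos by (simp add: \<rho>_def \<theta>_def)
    then show ?thesis by (rule power2_less_imp_less) simp
  qed
  have nz: "q z + c \<noteq> 0" if "norm z < 1" for z using key [OF that] by auto
  have q0: "q 0 = 1" by (simp add: q_def l_def L0)
  have c1: "1 + c \<noteq> 0" using nz [of 0] q0 by simp
  have w1: "norm (w z) < 1" if "norm z < 1" for z
    using key [OF that] nz [OF that] by (simp add: w_def norm_divide)
  have "exp (L z) = sector_map c \<alpha> (w z)" if z: "norm z < 1" for z
  proof -
    let ?m = "Ln (1 + c * w z) - Ln (1 - w z)"
    have Re: "0 < Re (1 + c * w z)" "0 < Re (1 - w z)"
      using Re_one_plus_pos [OF c w1 [OF z]] Re_one_plus_pos [of "-1" "w z"] w1 [OF z] by auto
    have ne: "x \<noteq> 0" if "0 < Re x" for x :: complex using that by auto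
    have nz': "1 + c * w z \<noteq> 0" "1 - w z \<noteq> 0" using ne Re by blast+
    have "q z * (1 - w z) = 1 + c * w z"
      using nz [OF z] by (simp add: w_def field_simps)
    then have e: "exp (l z) = exp ?m"
      using nz' by (simp add: exp_diff q_def field_simps)
    \<comment> \<open>Both imaginary parts have modulus below \<open>pi\<close>, the first since
      \<open>\<bar>\<psi>\<bar> < pi / 2\<close>, the second as a difference of two arguments below
      \<open>pi / 2\<close> in modulus. Equal exponentials then force equality.\<close>
    have "\<bar>Im (l z) - Im ?m\<bar> < 2 * pi"
    proof -
      have "\<bar>Im (Ln (1 + c * w z))\<bar> < pi / 2" "\<bar>Im (Ln (1 - w z))\<bar> < pi / 2"
        using Re Re_Ln_pos_lt [of "1 + c * w z"] Re_Ln_pos_lt [of "1 - w z"] nz' by auto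
      moreover have "Im ?m = Im (Ln (1 + c * w z)) - Im (Ln (1 - w z))" by simp
      ultimately show ?thesis using ang [OF z] \<psi> by linarith
    qed
    then have "l z = ?m" using e by (rule exp_complex_eqI)
    moreover have "L z = of_real \<alpha> * l z" using \<alpha> by (simp add: l_def)
    ultimately show ?thesis by (simp only: sector_map_def)
  qed
  moreover have "w holomorphic_on ball 0 1"
    unfolding w_def q_def l_def using nz \<alpha>
    by (intro holomorphic_intros holL) (auto simp: q_def l_def)
  moreover have "w 0 = 0" by (simp add: w_def q0)
  ultimately show thesis using that c w1 by blast
qed

subsection \<open>Concave functions\<close>

text \<open>Directions from a fixed point of \<open>E\<close> to points escaping to infinity
  accumulate on the compact unit circle; convexity and closedness make the limit a recession
  direction.\<close>

lemma unbounded_closed_convex_recession: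
  fixes E :: "complex set"
  assumes "closed E" "convex E" "\<not> bounded E"
  obtains u where "u \<noteq> 0" "u \<in> recession_cone E"
proof -
  obtain p where p: "p \<in> E" using assms(3) by fastforce
  have "\<exists>x\<in>E. real n < norm (x - p)" for n
  proof (rule ccontr)
    assume "\<not> (\<exists>x\<in>E. real n < norm (x - p))"
    then have "E \<subseteq> cball p (real n)" by (auto simp: dist_norm norm_minus_commute not_less)
    then show False using assms(3) bounded_cball bounded_subset by blast
  qed
  then obtain x where xE: "\<And>n. x n \<in> E" and xn: "\<And>n. real n < norm (x n - p)" by metis
  define d where "d n = norm (x n - p)" for n
  have d0: "0 < d n" for n
    using le_less_trans [OF of_nat_0_le_iff xn] by (simp add: d_def)
  have dir: "\<forall>n. (x n - p) /\<^sub>R d n \<in> sphere 0 1"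
  proof
    show "(x n - p) /\<^sub>R d n \<in> sphere 0 1" for n
      using d0 [of n] by (simp add: d_def)
  qed
  obtain u s where u: "u \<in> sphere 0 1" and s: "strict_mono s"
    and lim: "((\<lambda>n. (x n - p) /\<^sub>R d n) \<circ> s) \<longlonglongrightarrow> u"
    by (rule seq_compactE [OF compact_imp_seq_compact [OF compact_sphere] dir])
  have d_top: "filterlim d at_top sequentially"
    by (rule filterlim_at_top_mono [OF filterlim_real_sequentially], rule always_eventually)
       (simp add: d_def less_imp_le [OF xn])
  have ds: "(\<lambda>n. inverse (d (s n))) \<longlonglongrightarrow> 0"
    using filterlim_compose [OF d_top filterlim_subseq [OF s]] by (rule tendsto_inverse_0_at_top)
  have "u \<in> recession_cone E"
    unfolding recession_cone_def
  proof (intro CollectI ballI allI impI)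
    fix y and t :: real assume y: "y \<in> E" and t: "0 \<le> t"
    \<comment> \<open>These points are convex combinations of \<open>y\<close> and
      \<open>x (s n)\<close> with weight \<open>t / d (s n)\<close> on the latter. The term with
      \<open>p - y\<close> appears because directions are measured from \<open>p\<close>; it
      vanishes in the limit.\<close>
    have "(\<lambda>n. y + t *\<^sub>R (((x (s n) - p) /\<^sub>R d (s n)) + inverse (d (s n)) *\<^sub>R (p - y))) \<longlonglongrightarrow> y + t *\<^sub>R (u + 0 *\<^sub>R (p - y))"
      using lim ds by (intro tendsto_intros) (simp_all add: o_def)
    moreover have "eventually (\<lambda>n. y + t *\<^sub>R (((x (s n) - p) /\<^sub>R d (s n)) + inverse (d (s n)) *\<^sub>R (p - y)) \<in> E) sequentially"
    proof (rule eventually_mono)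
      show "eventually (\<lambda>n. t \<le> d (s n)) sequentially"
        using filterlim_compose [OF d_top filterlim_subseq [OF s]] by (simp add: filterlim_at_top)
      fix n assume n: "t \<le> d (s n)"
      define \<tau> where "\<tau> = t / d (s n)"
      have "0 \<le> \<tau>" "\<tau> \<le> 1" using n t d0 [of "s n"] by (auto simp: \<tau>_def)
      then have "(1 - \<tau>) *\<^sub>R y + \<tau> *\<^sub>R x (s n) \<in> E"
        using assms(2) y xE by (simp add: convex_alt)
      also have "(1 - \<tau>) *\<^sub>R y + \<tau> *\<^sub>R x (s n) =
          y + t *\<^sub>R (((x (s n) - p) /\<^sub>R d (s n)) + inverse (d (s n)) *\<^sub>R (p - y))"
        using d0 [of "s n"] by (simp add: \<tau>_def algebra_simps divide_inverse)
      finally show "y + t *\<^sub>R (((x (s n) - p) /\<^sub>R d (s n)) + inverse (d (s n)) *\<^sub>R (p - y)) \<in> E" .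
    qed
    ultimately have "y + t *\<^sub>R (u + 0 *\<^sub>R (p - y)) \<in> E"
      using assms(1) by (intro Lim_in_closed_set [OF assms(1) _ sequentially_bot])
    then show "y + t *\<^sub>R u \<in> E" by simp
  qed
  moreover have "u \<noteq> 0" using u by auto
  ultimately show thesis using that by blast
qed

text \<open>An empty complement would make the inverse of \<open>\<phi>\<close> a bounded entire
  function, against Liouville. The image is simply connected, so every component of its complement
  is unbounded, and a convex complement is a single component.\<close>

lemma complement_conformal_image:
  assumes hol: "\<phi> holomorphic_on ball 0 1" and inj: "inj_on \<phi> (ball 0 1)"
    and conv: "convex (- (\<phi> ` ball 0 1))"
  shows "closed (- (\<phi> ` ball 0 1))" "- (\<phi> ` ball 0 1) \<noteq> {}" "\<not> bounded (- (\<phi> ` ball 0 1))"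
proof -
  let ?G = "\<phi> ` ball 0 1"
  have open_G: "open ?G" by (rule open_mapping_thm3 [OF hol open_ball inj])
  then show "closed (- ?G)" by (simp add: closed_def)
  obtain g where holg: "g holomorphic_on ?G" and g: "\<And>z. z \<in> ball 0 1 \<Longrightarrow> g (\<phi> z) = z"
    using holomorphic_has_inverse [OF hol open_ball inj] by metis
  show ne: "- ?G \<noteq> {}"
  proof
    assume "- ?G = {}"
    then have U: "?G = UNIV" by blast
    then have "range g \<subseteq> ball 0 1" using g by (metis (no_types, lifting) image_iff image_subsetI UNIV_I)
    then have "bounded (range g)" using bounded_ball bounded_subset by blast
    then have "g constant_on UNIV" using holg U by (intro Liouville_theorem) auto
    then have "g (\<phi> 0) = g (\<phi> (1/2))" by (auto simp: constant_on_def)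
    then show False using g [of 0] g [of "1/2"] by simp
  qed
  have "homeomorphism (ball 0 1) ?G \<phi> g"
    using hol holg g by (intro homeomorphismI) (auto intro: holomorphic_on_imp_continuous_on)
  then have "simply_connected ?G"
    using homeomorphic_simply_connected [of "ball 0 1" ?G] convex_imp_simply_connected [OF convex_ball]
    by (auto simp: homeomorphic_def)
  moreover have "- ?G \<in> components (- ?G)"
    using ne conv by (simp add: in_components_self convex_connected)
  ultimately show "\<not> bounded (- ?G)"
    using simply_connected_eq_unbounded_complement_components [OF open_G] by blast
qed

text \<open>The two progressions cut the line into gaps of lengths
  \<open>\<bar>\<delta>\<bar>\<close> and \<open>2 * pi - \<bar>\<delta>\<bar>\<close>. The
  connected set stays in one gap, and the second length is the larger one because
  \<open>\<bar>\<delta>\<bar> \<le> pi\<close>.\<close>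

lemma interval_avoiding_progressions:
  fixes S :: "real set"
  assumes S: "connected S" "0 \<in> S" and \<delta>: "\<bar>\<delta>\<bar> \<le> pi"
    and avoid: "\<And>k::int. \<tau> + 2 * pi * k \<notin> S" "\<And>k::int. \<tau> + \<delta> + 2 * pi * k \<notin> S"
  shows "\<exists>A B. B - A \<le> 2 * pi - \<bar>\<delta>\<bar> \<and> S \<subseteq> {A<..<B}"
proof -
  define lo where "lo = min \<tau> (\<tau> + \<delta>)"
  have hi: "lo + \<bar>\<delta>\<bar> = max \<tau> (\<tau> + \<delta>)" by (auto simp: lo_def)
  have avoid': "lo + 2 * pi * k \<notin> S" "lo + \<bar>\<delta>\<bar> + 2 * pi * k \<notin> S" for k :: int
    using avoid [of k] unfolding hi by (auto simp: lo_def min_def max_def)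
  have sub: "S \<subseteq> {A<..<B}" if "A < 0" "0 < B" "A \<notin> S" "B \<notin> S" for A B
  proof
    fix x assume x: "x \<in> S"
    have "A \<notin> {x..0}" using connected_contains_Icc [OF S(1) x S(2)] that by blast
    moreover have "B \<notin> {0..x}" using connected_contains_Icc [OF S(1) S(2) x] that by blast
    ultimately show "x \<in> {A<..<B}" using that by auto
  qed
  \<comment> \<open>With this \<open>k\<close>, \<open>P\<close> is the last point at or below 0 of
    the progression through \<open>lo\<close>; it is not 0 because 0 belongs to
    \<open>S\<close>.\<close>
  define k where "k = \<lfloor>- lo / (2 * pi)\<rfloor>"
  define P where "P = lo + 2 * pi * k"
  have PS: "P \<notin> S" "P + \<bar>\<delta>\<bar> \<notin> S" "P + 2 * pi \<notin> S"
    using avoid' [of k] avoid'(1) [of "k + 1"] by (auto simp: P_def algebra_simps)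
  have "of_int k \<le> - lo / (2 * pi)" "- lo / (2 * pi) < of_int k + 1"
    unfolding k_def by linarith+
  then have "P \<le> 0" "0 < P + 2 * pi"
    by (auto simp: P_def field_simps)
  with PS S have P: "P < 0" "0 < P + 2 * pi" "P + \<bar>\<delta>\<bar> \<noteq> 0"
    by (auto simp: less_le)
  show ?thesis
  proof (cases "0 < P + \<bar>\<delta>\<bar>")
    case True
    then have "S \<subseteq> {P<..<P + \<bar>\<delta>\<bar>}" using P PS by (intro sub) auto
    moreover have "P + \<bar>\<delta>\<bar> - P \<le> 2 * pi - \<bar>\<delta>\<bar>" using \<delta> by simp
    ultimately show ?thesis by blast
  next
    case False
    then have "S \<subseteq> {P + \<bar>\<delta>\<bar><..<P + 2 * pi}" using P PS by (intro sub) auto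
    moreover have "P + 2 * pi - (P + \<bar>\<delta>\<bar>) \<le> 2 * pi - \<bar>\<delta>\<bar>" by simp
    ultimately show ?thesis by blast
  qed
qed

text \<open>
  The rays from the boundary point \<open>p\<close> nearest to \<open>0\<close> in two directions of the recession cone
  avoid the image of \<open>\<phi>\<close>, so that a logarithm of \<open>1 - \<phi> / p\<close> takes values in a strip.
\<close>

lemma concave_class_log:
  assumes "\<phi> \<in> concave_class \<alpha>"
  obtains p L where "p \<noteq> 0" "norm p = infdist 0 (frontier (\<phi> ` ball 0 1))"
    "L holomorphic_on ball 0 1" "L 0 = 0" "\<And>z. norm z < 1 \<Longrightarrow> exp (L z) = 1 - \<phi> z / p"
    "\<And>\<beta>. \<beta> < pi * (2 - \<alpha>) \<or> \<beta> \<le> 0 \<Longrightarrow>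
      \<exists>A B. B - A \<le> 2 * pi - \<beta> \<and> (\<forall>z. norm z < 1 \<longrightarrow> A < Im (L z) \<and> Im (L z) < B)"
proof -
  let ?G = "\<phi> ` ball 0 1"
  let ?E = "- ?G" and ?C = "recession_cone (- ?G)"
  from assms have hol: "\<phi> holomorphic_on ball 0 1" and \<phi>0: "\<phi> 0 = 0" and inj: "inj_on \<phi> (ball 0 1)"
    and conv: "convex ?E" and angle: "opening_angle ?G \<le> pi * \<alpha>"
    by (auto simp: concave_class_def)
  note E = complement_conformal_image [OF hol inj conv]
  have G0: "0 \<in> ?G" using \<phi>0 by (metis centre_in_ball image_eqI zero_less_one)
  have "frontier ?G \<noteq> {}"
    using E(2) G0 by (auto simp: frontier_eq_empty)
  then obtain p where p: "p \<in> frontier ?G" and pd: "infdist 0 (frontier ?G) = dist 0 p"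
    using infdist_attains_inf [OF frontier_closed] by metis
  have "frontier ?G \<subseteq> ?E"
    using frontier_subset_closed [OF E(1)] by (simp add: frontier_complement)
  with p have pE: "p \<in> ?E" by blast
  have p0: "p \<noteq> 0" using pE G0 by blast
  have nz: "1 - \<phi> z / p \<noteq> 0" if "z \<in> ball 0 1" for z
    using that pE p0 by (auto simp: field_simps)
  obtain L0 where holL0: "L0 holomorphic_on ball 0 1" and L0: "\<And>z. z \<in> ball 0 1 \<Longrightarrow> exp (L0 z) = 1 - \<phi> z / p"
  proof (rule holomorphic_logarithm_exists [OF convex_ball open_ball, of "\<lambda>z. 1 - \<phi> z / p" 0 1 0])
    show "(\<lambda>z. 1 - \<phi> z / p) holomorphic_on ball 0 1" by (intro holomorphic_intros hol p0)
  qed (use nz in auto)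
  define L where "L z = L0 z - L0 0" for z
  have holL: "L holomorphic_on ball 0 1" unfolding L_def by (intro holomorphic_intros holL0)
  have L: "exp (L z) = 1 - \<phi> z / p" if "norm z < 1" for z
    using L0 [of z] L0 [of 0] \<phi>0 that by (simp add: L_def exp_diff)
  \<comment> \<open>On the ray \<open>p + t u\<close> the function \<open>1 - x / p\<close> equals
    \<open>- t u / p\<close>. A value of \<open>L\<close> with the argument of
    \<open>- u / p\<close> would therefore put \<open>\<phi> z\<close> on that ray, which lies in
    the complement.\<close>
  have avoid: "\<tau> + 2 * pi * of_int k \<noteq> Im (L z)"
    if z: "norm z < 1" and u: "u \<in> ?C" and s: "0 < s" "- u / p = of_real s * cis \<tau>" for z u \<tau> s and k :: int
  proof
    assume "\<tau> + 2 * pi * of_int k = Im (L z)"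
    from this [symmetric] have "cis (Im (L z)) = cis \<tau>"
      by (simp add: cis_conv_exp exp_eq) (simp add: algebra_simps; blast)
    then have "exp (L z) = of_real (exp (Re (L z))) * cis \<tau>"
      by (simp add: exp_eq_polar)
    also have "\<dots> = of_real (exp (Re (L z)) / s) * (- u / p)"
      using s(1) unfolding s(2) by simp
    finally have "\<phi> z = p + (exp (Re (L z)) / s) *\<^sub>R u"
      using p0 L [OF z] by (simp add: field_simps scaleR_conv_of_real)
    also have "\<dots> \<in> ?E"
      using u pE s(1) unfolding recession_cone_def by auto
    finally show False using z by auto
  qed
  obtain u0 where u0: "u0 \<noteq> 0" "u0 \<in> ?C"
    using unbounded_closed_convex_recession [OF E(1) conv E(3)] by blast
  have "\<exists>A B. B - A \<le> 2 * pi - \<beta> \<and> (\<forall>z. norm z < 1 \<longrightarrow> A < Im (L z) \<and> Im (L z) < B)"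
    if \<beta>: "\<beta> < pi * (2 - \<alpha>) \<or> \<beta> \<le> 0" for \<beta>
  proof -
    \<comment> \<open>A positive \<open>\<beta>\<close> is strictly below the supremum defining the
      cone angle, so some pair of directions exceeds it whether or not the supremum is attained. For
      \<open>\<beta> \<le> 0\<close> one direction taken twice will do.\<close>
    obtain u v where uv: "u \<in> ?C" "v \<in> ?C" "u \<noteq> 0" "v \<noteq> 0" "\<beta> \<le> \<bar>Arg (u / v)\<bar>"
    proof (cases "\<beta> \<le> 0")
      case True
      then show thesis using that [of u0 u0] u0 by simp
    next
      case False
      with \<beta> angle have "\<beta> < Sup {\<bar>Arg (u / v)\<bar> | u v. u \<in> ?C - {0} \<and> v \<in> ?C - {0}}"
        by (simp add: opening_angle_def cone_angle_def algebra_simps)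
      moreover have "{\<bar>Arg (u / v)\<bar> | u v. u \<in> ?C - {0} \<and> v \<in> ?C - {0}} \<noteq> {}"
        using u0 by blast
      ultimately have "\<exists>x\<in>{\<bar>Arg (u / v)\<bar> | u v. u \<in> ?C - {0} \<and> v \<in> ?C - {0}}. \<beta> < x"
        by (intro less_cSupD)
      then show thesis using that by (auto intro: less_imp_le)
    qed
    define \<tau> where "\<tau> = Arg (- v / p)"
    define \<delta> where "\<delta> = Arg (u / v)"
    have v: "- v / p = of_real (norm (v / p)) * cis \<tau>"
      using Arg_eq [of "- v / p"] uv p0 by (simp add: \<tau>_def norm_divide cis_conv_exp)
    have "u / v = of_real (norm (u / v)) * cis \<delta>"
      using Arg_eq [of "u / v"] uv by (simp add: \<delta>_def norm_divide cis_conv_exp)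
    from arg_cong2 [OF this v, of "(*)"]
    have "(u / v) * (- v / p) = of_real (norm (u / v) * norm (v / p)) * cis (\<tau> + \<delta>)"
      by (simp only: cis_mult [symmetric] of_real_mult mult_ac)
    then have u: "- u / p = of_real (norm (u / v) * norm (v / p)) * cis (\<tau> + \<delta>)"
      using uv by (simp add: field_simps)
    have "\<exists>A B. B - A \<le> 2 * pi - \<bar>\<delta>\<bar> \<and> (Im \<circ> L) ` ball 0 1 \<subseteq> {A<..<B}"
    proof (rule interval_avoiding_progressions)
      show "connected ((Im \<circ> L) ` ball 0 1)"
        using holomorphic_on_imp_continuous_on [OF holL]
        by (intro connected_continuous_image) (auto intro!: continuous_intros simp: o_def)
      show "0 \<in> (Im \<circ> L) ` ball 0 1"
        by (rule image_eqI [of _ _ 0]) (auto simp: L_def)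
      show "\<bar>\<delta>\<bar> \<le> pi" using Arg_le_pi [of "u / v"] mpi_less_Arg [of "u / v"] by (simp add: \<delta>_def)
      show "\<tau> + 2 * pi * of_int k \<notin> (Im \<circ> L) ` ball 0 1" for k :: int
        using avoid [OF _ uv(2) _ v] uv p0 by auto
      show "\<tau> + \<delta> + 2 * pi * of_int k \<notin> (Im \<circ> L) ` ball 0 1" for k :: int
        using avoid [OF _ uv(1) _ u] uv p0 by auto
    qed
    then obtain A B where AB: "B - A \<le> 2 * pi - \<bar>\<delta>\<bar>" "(Im \<circ> L) ` ball 0 1 \<subseteq> {A<..<B}" by blast
    then have "B - A \<le> 2 * pi - \<beta>" using uv(5) by (simp add: \<delta>_def)
    moreover have "\<forall>z. norm z < 1 \<longrightarrow> A < Im (L z) \<and> Im (L z) < B"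
      using AB(2) by (simp add: image_subset_iff)
    ultimately show ?thesis by blast
  qed
  moreover have "norm p = infdist 0 (frontier ?G)" using pd by simp
  moreover have "L 0 = 0" by (simp add: L_def)
  ultimately show thesis using that [of p L] p0 holL L by blast
qed

text \<open>Composing the logarithm of \<open>1 - \<phi> / p\<close> with the Schwarz function of
  \<open>h\<close> makes \<open>1 - h / p\<close> subordinate to a sector map. The strip estimate
  requires \<open>\<beta>\<close> strictly below \<open>pi * (2 - \<alpha>)\<close>, hence an
  exponent \<open>\<alpha>' > \<alpha>\<close> that then decreases to \<open>\<alpha>\<close>; for
  \<open>\<alpha> = 2\<close> the choice \<open>\<beta> = 0\<close> is direct.\<close>

lemma subordinate_concave_coeffs_le:
  assumes \<phi>: "\<phi> \<in> concave_class \<alpha>" and \<alpha>: "1 \<le> \<alpha>" "\<alpha> \<le> 2"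
    and sub: "subordinate h \<phi>" and H: "h has_fps_expansion H"
    and r: "0 \<le> r" "r \<le> 1/5"
  shows "(\<Sum>n\<le>N. norm (fps_nth H (Suc n)) * r ^ Suc n) \<le>
           infdist 0 (frontier (\<phi> ` ball 0 1)) * (((1 + r) / (1 - r)) powr \<alpha> - 1)"
proof -
  let ?d = "infdist 0 (frontier (\<phi> ` ball 0 1))"
  let ?X = "(1 + r) / (1 - r)" and ?s = "\<Sum>n\<le>N. norm (fps_nth H (Suc n)) * r ^ Suc n"
  obtain p L where p: "p \<noteq> 0" "norm p = ?d" and holL: "L holomorphic_on ball 0 1" and L0: "L 0 = 0"
    and L: "\<And>z. norm z < 1 \<Longrightarrow> exp (L z) = 1 - \<phi> z / p"
    and strip: "\<And>\<beta>. \<beta> < pi * (2 - \<alpha>) \<or> \<beta> \<le> 0 \<Longrightarrow>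
      \<exists>A B. B - A \<le> 2 * pi - \<beta> \<and> (\<forall>z. norm z < 1 \<longrightarrow> A < Im (L z) \<and> Im (L z) < B)"
    by (rule concave_class_log [OF \<phi>]) blast
  obtain v where holv: "v holomorphic_on ball 0 1" and v1: "v ` ball 0 1 \<subseteq> ball 0 1" and v0: "v 0 = 0"
    and hv: "\<And>z. z \<in> ball 0 1 \<Longrightarrow> h z = \<phi> (v z)"
    using sub unfolding subordinate_def by blast
  have v1': "norm (v z) < 1" if "norm z < 1" for z using v1 that by (simp add: image_subset_iff)
  have holLv: "(\<lambda>z. L (v z)) holomorphic_on ball 0 1"
    using holomorphic_on_compose_gen [OF holv holL v1] by (simp add: o_def)
  define F where "F = 1 - fps_const (1 / p) * H"
  have F: "(\<lambda>z. 1 - 1 / p * h z) has_fps_expansion F"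
    unfolding F_def by (intro fps_expansion_intros H)
  have le: "?s \<le> ?d * (?X powr \<alpha>' - 1)" if \<alpha>': "\<alpha> < \<alpha>' \<or> \<alpha>' = 2" "\<alpha>' \<le> 2" for \<alpha>'
  proof -
    have "pi * (2 - \<alpha>') < pi * (2 - \<alpha>) \<or> pi * (2 - \<alpha>') \<le> 0" using \<alpha>' by auto
    from strip [OF this] obtain A B where AB: "B - A \<le> 2 * pi - pi * (2 - \<alpha>')"
      "\<And>z. norm z < 1 \<Longrightarrow> A < Im (L z) \<and> Im (L z) < B" by blast
    have width: "B - A \<le> pi * \<alpha>'" using AB(1) by (simp add: algebra_simps)
    have pos: "0 < \<alpha>'" "1 \<le> \<alpha>'" using \<alpha> \<alpha>' by auto
    obtain c w where cw: "norm c = 1" "w holomorphic_on ball 0 1" "\<And>z. norm z < 1 \<Longrightarrow> norm (w z) < 1"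
      "w 0 = 0" "\<And>z. norm z < 1 \<Longrightarrow> exp (L (v z)) = sector_map c \<alpha>' (w z)"
      by (rule strip_imp_subordinate_sector_map [OF holLv _ pos(1) AB(2) width])
         (simp_all add: v0 L0 v1')
    have "(\<Sum>n\<le>N. norm (fps_nth F (Suc n)) * r ^ Suc n) \<le> ?X powr \<alpha>' - 1"
    proof (rule sum_subordinate_sector_map_coeffs_le [OF cw(1) pos(2) \<alpha>'(2) cw(2-4) F _ r])
      fix z :: complex assume z: "norm z < 1"
      have "1 - 1 / p * h z = exp (L (v z))"
        using L [OF v1' [OF z]] hv [of z] z by simp
      then show "1 - 1 / p * h z = sector_map c \<alpha>' (w z)"
        using cw(5) [OF z] by (rule trans)
    qed
    also have "(\<Sum>n\<le>N. norm (fps_nth F (Suc n)) * r ^ Suc n) = ?s / norm p"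
      by (simp add: F_def norm_mult norm_divide sum_divide_distrib)
    finally have "?s \<le> (?X powr \<alpha>' - 1) * norm p"
      using p(1) by (subst (asm) pos_divide_le_eq) auto
    then show ?thesis unfolding p(2) by (simp only: mult.commute)
  qed
  show ?thesis
  proof (cases "\<alpha> = 2")
    case True
    then show ?thesis using le [of 2] by simp
  next
    case False
    have X: "0 < ?X" using r by simp
    show ?thesis
    proof (rule tendsto_lowerbound)
      show "((\<lambda>\<alpha>'. ?d * (?X powr \<alpha>' - 1)) \<longlongrightarrow> ?d * (?X powr \<alpha> - 1)) (at_right \<alpha>)"
        using X by (intro tendsto_intros) auto
      show "eventually (\<lambda>\<alpha>'. ?s \<le> ?d * (?X powr \<alpha>' - 1)) (at_right \<alpha>)"
        using False \<alpha> by (intro eventually_at_rightI [of _ 2] le) auto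
    qed simp
  qed
qed

section \<open>The radius equation and the inequality up to its root\<close>

lemma ratio_powr_strict_mono:
  fixes r s \<alpha> :: real
  assumes "0 \<le> r" "r < s" "s < 1" "0 < \<alpha>"
  shows "((1 + r) / (1 - r)) powr \<alpha> < ((1 + s) / (1 - s)) powr \<alpha>"
proof (rule powr_less_mono2)
  show "(1 + r) / (1 - r) < (1 + s) / (1 - s)"
    using assms by (simp add: field_simps)
qed (use assms in auto)

text \<open>The factor is \<open>2 + k\<close> with \<open>k = (K - 1) / (K + 1)\<close>.\<close>

lemma bohr_factor_ge_2: "1 \<le> K \<Longrightarrow> 2 \<le> (3 * K + 1) / (K + 1)" for K :: real
  by (simp add: field_simps)

text \<open>At \<open>r = 1/5\<close> the quotient is \<open>3/2\<close>, so the left side of the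
  equation is already at least \<open>2 * (3/2 - 1) - 1 = 0\<close>. Up to the root the estimates
  for \<open>r \<le> 1/5\<close> thus apply.\<close>

lemma bohr_root_le:
  fixes r :: real
  assumes "1 \<le> K" "1 \<le> \<alpha>" "0 < r" "r < 1/3" "bohr_equation K \<alpha> r"
  shows "r \<le> 1/5"
proof (rule ccontr)
  assume "\<not> r \<le> 1/5"
  then have "((1 + 1/5) / (1 - 1/5)) powr \<alpha> < ((1 + r) / (1 - r)) powr \<alpha>"
    using assms by (intro ratio_powr_strict_mono) auto
  moreover have "(3/2) powr 1 \<le> (3/2::real) powr \<alpha>"
    using assms by (intro powr_mono) auto
  ultimately have "1/2 < ((1 + r) / (1 - r)) powr \<alpha> - 1" by simp
  then have "2 * (1/2) < (3 * K + 1) / (K + 1) * (((1 + r) / (1 - r)) powr \<alpha> - 1)"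
    using bohr_factor_ge_2 [OF assms(1)] by (intro mult_le_less_imp_less) auto
  then show False using assms(5) unfolding bohr_equation_def by linarith
qed

text \<open>Both \<open>norm (h z)\<close> and the sum over \<open>a\<close> are at most
  \<open>T\<close>, the sum over \<open>b\<close> is at most \<open>k * T\<close>, and
  \<open>(2 + k) * T \<le> d\<close> by the equation at \<open>r0\<close> and monotonicity.\<close>

lemma bohr_inequality_at_root:
  assumes K: "1 \<le> K" and \<alpha>: "1 \<le> \<alpha>" "\<alpha> \<le> 2" and r0: "0 < r0" "r0 < 1/3" "bohr_equation K \<alpha> r0"
  shows "bohr_inequality_upto K \<alpha> r0"
  unfolding bohr_inequality_upto_def
proof (intro allI impI ballI)
  fix f h g \<phi> :: "complex \<Rightarrow> complex" and a b :: "nat \<Rightarrow> complex" and z :: complex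
  assume harm: "harmonic_mapping f h g"
    and a: "\<forall>z\<in>ball 0 1. (\<lambda>n. a n * z ^ n) sums h z"
    and b: "\<forall>z\<in>ball 0 1. (\<lambda>n. b (Suc n) * z ^ Suc n) sums g z"
    and sp: "sense_preserving h g" and qc: "quasiconformal K h g"
    and \<phi>: "\<phi> \<in> concave_class \<alpha>" and sub: "subordinate h \<phi>"
    and z: "z \<in> ball 0 1" and zr: "norm z \<le> r0"
  define r where "r = norm z"
  have r: "0 \<le> r" "r \<le> 1/5" "r \<le> r0"
    using zr bohr_root_le [OF K \<alpha>(1) r0] by (auto simp: r_def)
  define d where "d = infdist 0 (frontier (\<phi> ` ball 0 1))"
  define T where "T = d * (((1 + r) / (1 - r)) powr \<alpha> - 1)"
  define k where "k = (K - 1) / (K + 1)"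
  have k: "0 \<le> k" using K by (simp add: k_def)
  have h: "h holomorphic_on ball 0 1" and g: "g holomorphic_on ball 0 1"
    using harm by (auto simp: harmonic_mapping_def)
  have \<phi>0: "\<phi> 0 = 0" using \<phi> by (simp add: concave_class_def)
  then have h0: "h 0 = 0" using sub by (auto simp: subordinate_def)
  define H where "H = Abs_fps a"
  have H: "h has_fps_expansion H"
    by (rule has_fps_expansionI, rule eventually_mono [OF eventually_nhds_in_open [of "ball 0 1"]])
       (use a in \<open>auto simp: H_def\<close>)
  \<comment> \<open>The series of \<open>g\<close> starts at \<open>n = 1\<close>, so its constant
    coefficient is set to 0.\<close>
  define G where "G = Abs_fps (\<lambda>n. if n = 0 then 0 else b n)"
  have G: "g has_fps_expansion G"
  proof (rule has_fps_expansionI, rule eventually_mono [OF eventually_nhds_in_open [of "ball 0 1"]])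
    fix u :: complex assume u: "u \<in> ball 0 1"
    have "(\<lambda>n. fps_nth G (Suc n) * u ^ Suc n) sums g u"
      using b u by (simp add: G_def)
    then have "(\<lambda>n. fps_nth G n * u ^ n) sums (g u + fps_nth G 0 * u ^ 0)"
      by (rule sums_Suc)
    then show "(\<lambda>n. fps_nth G n * u ^ n) sums g u" by (simp add: G_def)
  qed auto
  have a_le: "(\<Sum>n\<le>N. norm (a (Suc n)) * r ^ Suc n) \<le> T" for N
    using subordinate_concave_coeffs_le [OF \<phi> \<alpha> sub H r(1,2), of N]
    by (simp add: H_def T_def d_def)
  have b_le: "(\<Sum>n\<le>N. norm (b (Suc n)) * r ^ Suc n) \<le> k * T" for N
  proof -
    have "(\<Sum>n\<le>N. norm (fps_nth G (Suc n)) * r ^ Suc n) \<le> k * (\<Sum>n\<le>N. norm (fps_nth H (Suc n)) * r ^ Suc n)"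
      using sp qc r
      by (intro sum_dilatation_coeffs_le [OF h g H G])
         (auto simp: sense_preserving_def quasiconformal_def dilatation_def k_def)
    also have "\<dots> \<le> k * T" using a_le [of N] k by (intro mult_left_mono) (simp_all add: H_def)
    finally show ?thesis by (simp add: G_def)
  qed
  have "norm (h z) \<le> T"
  proof (rule Lim_norm_ubound [OF sequentially_bot])
    have "fps_nth H 0 = 0" using has_fps_expansion_imp_0_eq_fps_nth_0 [OF H] h0 by simp
    then have "(\<lambda>n. a (Suc n) * z ^ Suc n) sums h z"
      using a z by (subst sums_Suc_iff) (simp add: H_def)
    then show "(\<lambda>N. \<Sum>n\<le>N. a (Suc n) * z ^ Suc n) \<longlonglongrightarrow> h z" by (simp only: sums_def_le)
    have "norm (\<Sum>n\<le>N. a (Suc n) * z ^ Suc n) \<le> T" for N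
    proof -
      have "norm (\<Sum>n\<le>N. a (Suc n) * z ^ Suc n) \<le> (\<Sum>n\<le>N. norm (a (Suc n)) * r ^ Suc n)"
        by (rule sum_norm_le) (simp add: norm_mult norm_power r_def)
      with a_le [of N] show ?thesis by linarith
    qed
    then show "eventually (\<lambda>N. norm (\<Sum>n\<le>N. a (Suc n) * z ^ Suc n) \<le> T) sequentially"
      by simp
  qed
  moreover have "(\<Sum>n. (norm (a (Suc n)) + norm (b (Suc n))) * r ^ Suc n) \<le> T + k * T"
  proof -
    let ?c = "\<lambda>n. (norm (a (Suc n)) + norm (b (Suc n))) * r ^ Suc n"
    have nn: "0 \<le> ?c n" for n using r by simp
    have le: "sum ?c {..<N} \<le> T + k * T" for N
    proof -
      have "sum ?c {..<N} \<le> sum ?c {..N}" using nn by (intro sum_mono2) auto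
      also have "\<dots> = (\<Sum>n\<le>N. norm (a (Suc n)) * r ^ Suc n) + (\<Sum>n\<le>N. norm (b (Suc n)) * r ^ Suc n)"
        by (simp only: distrib_right sum.distrib)
      also have "\<dots> \<le> T + k * T" by (intro add_mono a_le b_le)
      finally show ?thesis .
    qed
    \<comment> \<open>The bounded partial sums give summability as well, so \<open>suminf\<close> is
      a genuine sum.\<close>
    show ?thesis using summableI_nonneg_bounded [OF nn le] le by (rule suminf_le_const)
  qed
  moreover have "T + (T + k * T) \<le> d"
  proof -
    have "((1 + r) / (1 - r)) powr \<alpha> \<le> ((1 + r0) / (1 - r0)) powr \<alpha>"
      using ratio_powr_strict_mono [of r r0 \<alpha>] r r0 \<alpha> by (cases "r = r0") (auto simp: less_le)
    then have "(3 * K + 1) / (K + 1) * (((1 + r) / (1 - r)) powr \<alpha> - 1) \<le>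
        (3 * K + 1) / (K + 1) * (((1 + r0) / (1 - r0)) powr \<alpha> - 1)"
      using K by (intro mult_left_mono) auto
    also have "\<dots> = 1" using r0(3) unfolding bohr_equation_def by linarith
    finally have "d * ((3 * K + 1) / (K + 1) * (((1 + r) / (1 - r)) powr \<alpha> - 1)) \<le> d * 1"
      by (intro mult_left_mono) (simp_all add: d_def infdist_nonneg)
    moreover have "T + (T + k * T) = (2 + k) * T" by (simp add: algebra_simps)
    moreover have "2 + k = (3 * K + 1) / (K + 1)" using K by (simp add: k_def field_simps)
    ultimately show ?thesis by (simp add: T_def mult_ac)
  qed
  ultimately show "norm (h z) + (\<Sum>n. (norm (a (Suc n)) + norm (b (Suc n))) * norm z ^ Suc n)
             \<le> norm (\<phi> 0) + infdist (\<phi> 0) (frontier (\<phi> ` ball 0 1))"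
    unfolding r_def d_def \<phi>0 norm_zero by linarith
qed

subsection \<open>The extremal function\<close>

lemma Moebius_half_plane:
  assumes "norm z < 1"
  shows "0 < Re ((1 + z) / (1 - z))"
proof -
  have "(Re z)\<^sup>2 + (Im z)\<^sup>2 < 1"
    using assms by (metis cmod_power2 norm_ge_zero power_less_one_iff zero_neq_numeral abs_norm_cancel abs_square_less_1)
  then show ?thesis
    by (simp add: Re_complex_div_gt_0 power2_eq_square algebra_simps)
qed

text \<open>The numbers \<open>1 + z\<close>, \<open>1 - z\<close> and their quotient have positive
  real part, so no multiple of \<open>2 * pi\<close> arises when the logarithms are
  combined.\<close>

lemma sector_map_1:
  assumes z: "norm z < 1"
  shows "sector_map 1 \<alpha> z = exp (of_real \<alpha> * Ln ((1 + z) / (1 - z)))"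
    and "\<bar>Im (Ln ((1 + z) / (1 - z)))\<bar> < pi / 2"
proof -
  have pos: "0 < Re (1 + z)" "0 < Re (1 - z)"
    using Re_one_plus_pos [of 1 z] Re_one_plus_pos [of "-1" z] z by auto
  have ne: "x \<noteq> 0" if "0 < Re x" for x :: complex using that by auto
  note ne' = ne [OF pos(1)] ne [OF pos(2)] ne [OF Moebius_half_plane [OF z]]
  show Im: "\<bar>Im (Ln ((1 + z) / (1 - z)))\<bar> < pi / 2"
    using Re_Ln_pos_lt [OF ne'(3)] Moebius_half_plane [OF z] by blast
  have "Ln (1 + z) - Ln (1 - z) = Ln ((1 + z) / (1 - z))"
  proof (rule exp_complex_eqI)
    have "\<bar>Im (Ln (1 + z))\<bar> < pi / 2" "\<bar>Im (Ln (1 - z))\<bar> < pi / 2"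
      using Re_Ln_pos_lt ne' pos by blast+
    moreover have "Im (Ln (1 + z) - Ln (1 - z)) = Im (Ln (1 + z)) - Im (Ln (1 - z))" by simp
    ultimately show "\<bar>Im (Ln (1 + z) - Ln (1 - z)) - Im (Ln ((1 + z) / (1 - z)))\<bar> < 2 * pi"
      using Im by linarith
    show "exp (Ln (1 + z) - Ln (1 - z)) = exp (Ln ((1 + z) / (1 - z)))"
      using ne' by (simp add: exp_diff)
  qed
  then show "sector_map 1 \<alpha> z = exp (of_real \<alpha> * Ln ((1 + z) / (1 - z)))"
    by (simp add: sector_map_def)
qed

text \<open>The exponents have imaginary parts in an open interval of length
  \<open>pi * \<alpha> \<le> 2 * pi\<close>, where the exponential is injective.\<close>

lemma inj_on_sector_map_1:
  assumes \<alpha>: "0 < \<alpha>" "\<alpha> \<le> 2"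
  shows "inj_on (sector_map 1 \<alpha>) (ball 0 1)"
proof (rule inj_onI)
  fix x y :: complex assume xy: "x \<in> ball 0 1" "y \<in> ball 0 1" and eq: "sector_map 1 \<alpha> x = sector_map 1 \<alpha> y"
  then have n: "norm x < 1" "norm y < 1" by auto
  let ?q = "\<lambda>z. (1 + z) / (1 - z)"
  have "of_real \<alpha> * Ln (?q x) = of_real \<alpha> * Ln (?q y)"
  proof (rule exp_complex_eqI)
    show "exp (of_real \<alpha> * Ln (?q x)) = exp (of_real \<alpha> * Ln (?q y))"
      using eq by (simp only: sector_map_1(1) [OF n(1)] sector_map_1(1) [OF n(2)])
    have "\<bar>Im (Ln (?q x)) - Im (Ln (?q y))\<bar> < pi"
      using sector_map_1(2) [OF n(1)] sector_map_1(2) [OF n(2)] by linarith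
    then have "\<alpha> * \<bar>Im (Ln (?q x)) - Im (Ln (?q y))\<bar> < 2 * pi"
      using \<alpha> by (intro mult_le_less_imp_less) auto
    moreover have "\<bar>Im (of_real \<alpha> * Ln (?q x)) - Im (of_real \<alpha> * Ln (?q y))\<bar> =
        \<bar>\<alpha> * (Im (Ln (?q x)) - Im (Ln (?q y)))\<bar>"
      by (simp add: right_diff_distrib)
    ultimately show "\<bar>Im (of_real \<alpha> * Ln (?q x)) - Im (of_real \<alpha> * Ln (?q y))\<bar> < 2 * pi"
      using \<alpha> by (simp add: abs_mult)
  qed
  then have "Ln (?q x) = Ln (?q y)" using \<alpha> by simp
  then have "exp (Ln (?q x)) = exp (Ln (?q y))" by (rule arg_cong)
  moreover have "?q x \<noteq> 0" "?q y \<noteq> 0"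
    using Moebius_half_plane [OF n(1)] Moebius_half_plane [OF n(2)] by fastforce+
  ultimately have "?q x = ?q y" by (metis exp_Ln)
  moreover have "x \<noteq> 1" "y \<noteq> 1" using n by auto
  ultimately show "x = y" by (simp add: field_simps)
qed

text \<open>The right side is the sector of half-angle \<open>\<alpha> * pi / 2\<close> about the
  positive axis, as cosine decreases on \<open>[0, pi]\<close>; the strict inequality excludes the
  vertex 0. In this form the convexity of the complement is easy to read off.\<close>

lemma sector_map_1_image:
  assumes \<alpha>: "1 \<le> \<alpha>" "\<alpha> \<le> 2"
  shows "sector_map 1 \<alpha> ` ball 0 1 = {x. norm x * cos (\<alpha> * pi / 2) < Re x}"
proof (intro equalityI subsetI)
  fix x assume "x \<in> sector_map 1 \<alpha> ` ball 0 1"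
  then obtain z where z: "norm z < 1" and x: "x = sector_map 1 \<alpha> z" by auto
  define m where "m = Ln ((1 + z) / (1 - z))"
  have "\<bar>Im m\<bar> < pi / 2" unfolding m_def by (rule sector_map_1(2) [OF z])
  then have "\<alpha> * \<bar>Im m\<bar> < \<alpha> * (pi / 2)" using \<alpha> by simp
  then have "\<bar>\<alpha> * Im m\<bar> < \<alpha> * pi / 2" using \<alpha> by (simp add: abs_mult)
  moreover have "\<alpha> * pi / 2 \<le> pi" using \<alpha> by simp
  ultimately have "cos (\<alpha> * pi / 2) < cos \<bar>\<alpha> * Im m\<bar>"
    by (intro cos_monotone_0_pi) auto
  then have "exp (\<alpha> * Re m) * cos (\<alpha> * pi / 2) < exp (\<alpha> * Re m) * cos (\<alpha> * Im m)" by simp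
  moreover have "x = exp (of_real \<alpha> * m)" unfolding x m_def by (rule sector_map_1(1) [OF z])
  ultimately show "x \<in> {x. norm x * cos (\<alpha> * pi / 2) < Re x}"
    by (simp add: Re_exp)
next
  fix x assume "x \<in> {x. norm x * cos (\<alpha> * pi / 2) < Re x}"
  then have x: "norm x * cos (\<alpha> * pi / 2) < Re x" by simp
  then have x0: "x \<noteq> 0" by auto
  define \<zeta> where "\<zeta> = Ln x"
  have ex: "exp \<zeta> = x" using x0 by (simp add: \<zeta>_def)
  have Im_le: "\<bar>Im \<zeta>\<bar> \<le> pi" using Im_Ln_le_pi [OF x0] mpi_less_Im_Ln [OF x0] by (simp add: \<zeta>_def)
  have "Re x = norm x * cos \<bar>Im \<zeta>\<bar>" unfolding ex [symmetric] by (simp add: Re_exp)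
  with x x0 have cos: "cos (\<alpha> * pi / 2) < cos \<bar>Im \<zeta>\<bar>" by simp
  have "\<bar>Im \<zeta>\<bar> < \<alpha> * pi / 2"
  proof (rule ccontr)
    assume "\<not> \<bar>Im \<zeta>\<bar> < \<alpha> * pi / 2"
    then have "cos \<bar>Im \<zeta>\<bar> \<le> cos (\<alpha> * pi / 2)"
      using \<alpha> Im_le by (intro cos_monotone_0_pi_le) auto
    with cos show False by simp
  qed
  then have Im: "\<bar>Im (\<zeta> / of_real \<alpha>)\<bar> < pi / 2"
    using \<alpha> by (simp add: field_simps)
  \<comment> \<open>The principal root \<open>q\<close> of order \<open>\<alpha>\<close> lies in the
    right half-plane, from which the inverse of \<open>(1 + z) / (1 - z)\<close> leads back to the
    disc.\<close>
  define q where "q = exp (\<zeta> / of_real \<alpha>)"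
  have "0 < cos (Im (\<zeta> / of_real \<alpha>))" using Im by (intro cos_gt_zero_pi) linarith+
  then have q: "0 < Re q" unfolding q_def Re_exp by simp
  have q1: "q + 1 \<noteq> 0"
  proof
    assume "q + 1 = 0"
    then have "Re q = -1" by (simp add: complex_eq_iff)
    with q show False by simp
  qed
  define z where "z = (q - 1) / (q + 1)"
  have "(norm (q - 1))\<^sup>2 < (norm (q + 1))\<^sup>2"
    unfolding cmod_power2 using q by (simp add: power2_eq_square algebra_simps)
  then have "norm (q - 1) < norm (q + 1)" by (rule power2_less_imp_less) simp
  then have z: "norm z < 1" using q1 by (simp add: z_def norm_divide)
  have "(1 + z) / (1 - z) = q"
  proof -
    have "1 + z = 2 * q / (q + 1)" "1 - z = 2 / (q + 1)"
      using q1 by (simp_all add: z_def field_simps)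
    then show ?thesis using q1 by simp
  qed
  moreover have "Ln q = \<zeta> / of_real \<alpha>"
    unfolding q_def using Im by (intro Ln_exp) linarith+
  ultimately have "sector_map 1 \<alpha> z = x"
    using \<alpha> ex by (simp add: sector_map_1(1) [OF z])
  then show "x \<in> sector_map 1 \<alpha> ` ball 0 1" using z by auto
qed

text \<open>For \<open>norm (1 - z) < 1\<close> one has \<open>norm (1 + z) \<ge> 1\<close>, so with
  \<open>\<alpha> \<ge> 1\<close> the modulus is at least \<open>1 / norm (1 - z)\<close>.\<close>

lemma sector_map_1_at_infinity:
  assumes \<alpha>: "1 \<le> \<alpha>"
  shows "filterlim (sector_map 1 \<alpha>) at_infinity (at 1 within ball 0 1)"
proof (rule filterlim_norm_at_top_imp_at_infinity, rule filterlim_at_top_mono)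
  have "((\<lambda>z::complex. norm (1 - z)) \<longlongrightarrow> norm (1 - 1 :: complex)) (at 1 within ball 0 1)"
    by (intro tendsto_intros)
  then show "filterlim (\<lambda>z. inverse (norm (1 - z))) at_top (at (1::complex) within ball 0 1)"
    by (intro filterlim_inverse_at_top) (auto simp: eventually_at_filter)
  show "eventually (\<lambda>z. inverse (norm (1 - z)) \<le> norm (sector_map 1 \<alpha> z)) (at 1 within ball 0 1)"
    unfolding eventually_at
  proof (intro exI [of _ 1] conjI ballI impI)
    fix z :: complex assume "z \<in> ball 0 1" and d: "z \<noteq> 1 \<and> dist z 1 < 1"
    have n: "0 < norm (1 - z)" "norm (1 - z) < 1" using d by (auto simp: dist_norm norm_minus_commute)
    have "norm ((1 + z) + (1 - z)) \<le> norm (1 + z) + norm (1 - z)" by (rule norm_triangle_ineq)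
    then have n1: "1 \<le> norm (1 + z)" using n by simp
    then have ne: "1 + z \<noteq> 0" "1 - z \<noteq> 0" using d by auto
    have "0 \<le> - ln (norm (1 - z))" using n by simp
    then have "1 * - ln (norm (1 - z)) \<le> \<alpha> * - ln (norm (1 - z))"
      using \<alpha> by (intro mult_right_mono)
    also have "\<dots> \<le> \<alpha> * (ln (norm (1 + z)) - ln (norm (1 - z)))"
      using n1 \<alpha> by (intro mult_left_mono) auto
    finally have "exp (- ln (norm (1 - z))) \<le> exp (\<alpha> * (ln (norm (1 + z)) - ln (norm (1 - z))))"
      by simp
    then show "inverse (norm (1 - z)) \<le> norm (sector_map 1 \<alpha> z)"
      using n ne by (simp add: sector_map_def Re_Ln exp_minus)
  qed simp
qed

text \<open>The divisor is the derivative of \<open>sector_map 1 \<alpha>\<close> at 0, which gives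
  the normalization required by \<open>concave_class\<close>.\<close>

definition extremal_map :: "real \<Rightarrow> complex \<Rightarrow> complex" where
  "extremal_map \<alpha> z = (sector_map 1 \<alpha> z - 1) / of_real (2 * \<alpha>)"

lemma extremal_map_has_field_derivative:
  assumes "norm z < 1" "\<alpha> \<noteq> 0"
  shows "(extremal_map \<alpha> has_field_derivative
           exp (of_real (\<alpha> - 1) * Ln (1 + 1 * z) - of_real (\<alpha> + 1) * Ln (1 - z))) (at z)"
  unfolding extremal_map_def
  by (rule derivative_eq_intros sector_map_has_field_derivative [of 1 z \<alpha>] refl assms | use assms in simp)+

lemma complement_extremal_image:
  assumes \<alpha>: "1 \<le> \<alpha>" "\<alpha> \<le> 2"
  shows "- (extremal_map \<alpha> ` ball 0 1) =
    {x. Re (of_real (2 * \<alpha>) * x + 1) \<le> norm (of_real (2 * \<alpha>) * x + 1) * cos (\<alpha> * pi / 2)}"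
proof -
  have "x \<in> extremal_map \<alpha> ` ball 0 1 \<longleftrightarrow> of_real (2 * \<alpha>) * x + 1 \<in> sector_map 1 \<alpha> ` ball 0 1" for x
  proof
    assume "x \<in> extremal_map \<alpha> ` ball 0 1"
    then obtain z where "z \<in> ball 0 1" "x = extremal_map \<alpha> z" by blast
    then show "of_real (2 * \<alpha>) * x + 1 \<in> sector_map 1 \<alpha> ` ball 0 1"
      using \<alpha> by (intro image_eqI [of _ _ z]) (auto simp: extremal_map_def)
  next
    assume "of_real (2 * \<alpha>) * x + 1 \<in> sector_map 1 \<alpha> ` ball 0 1"
    then obtain z where z: "z \<in> ball 0 1" "sector_map 1 \<alpha> z = of_real (2 * \<alpha>) * x + 1" by force
    then have "extremal_map \<alpha> z = x" using \<alpha> by (simp add: extremal_map_def)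
    then show "x \<in> extremal_map \<alpha> ` ball 0 1" using z by blast
  qed
  then show ?thesis
    unfolding sector_map_1_image [OF \<alpha>]
    by (simp only: set_eq_iff Compl_iff mem_Collect_eq not_less simp_thms)
qed

lemma cos_obtuse_nonpos: "1 \<le> \<alpha> \<Longrightarrow> \<alpha> \<le> 2 \<Longrightarrow> cos (\<alpha> * pi / 2) \<le> 0"
  using cos_monotone_0_pi_le [of "pi / 2" "\<alpha> * pi / 2"] by simp

text \<open>A lower bound for the cone angle is wanted, and the two edge directions
  \<open>cis (\<alpha> * pi / 2)\<close> and \<open>cis (- (\<alpha> * pi / 2))\<close> of the
  complement provide it.\<close>

lemma opening_angle_extremal_map_le:
  assumes \<alpha>: "1 \<le> \<alpha>" "\<alpha> \<le> 2"
  shows "opening_angle (extremal_map \<alpha> ` ball 0 1) \<le> pi * \<alpha>"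
proof -
  let ?C = "recession_cone (- (extremal_map \<alpha> ` ball 0 1))"
  define \<gamma> where "\<gamma> = cos (\<alpha> * pi / 2)"
  have \<gamma>: "\<gamma> \<le> 0" unfolding \<gamma>_def by (rule cos_obtuse_nonpos [OF \<alpha>])
  \<comment> \<open>Moving along \<open>u\<close> changes the real part by exactly
    \<open>s * \<gamma>\<close> and raises the norm by at most \<open>s\<close>; since
    \<open>\<gamma> \<le> 0\<close>, the inequality persists.\<close>
  have mem: "u \<in> ?C" if u: "Re u = \<gamma>" "norm u = 1" for u
    unfolding recession_cone_def complement_extremal_image [OF \<alpha>]
  proof (intro CollectI ballI allI impI, elim CollectE)
    fix x and t :: real
    assume t: "0 \<le> t" and "Re (of_real (2 * \<alpha>) * x + 1) \<le> norm (of_real (2 * \<alpha>) * x + 1) * cos (\<alpha> * pi / 2)"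
    define y where "y = of_real (2 * \<alpha>) * x + 1"
    have y: "Re y \<le> norm y * \<gamma>" unfolding y_def \<gamma>_def by fact
    define s where "s = 2 * \<alpha> * t"
    have s: "0 \<le> s" using t \<alpha> by (simp add: s_def)
    have eq: "of_real (2 * \<alpha>) * (x + t *\<^sub>R u) + 1 = y + s *\<^sub>R u"
      by (simp add: y_def s_def scaleR_conv_of_real algebra_simps)
    have "norm (y + s *\<^sub>R u) \<le> norm y + s"
      using norm_triangle_ineq [of y "s *\<^sub>R u"] s u by simp
    then have "(norm y + s) * \<gamma> \<le> norm (y + s *\<^sub>R u) * \<gamma>"
      using \<gamma> by (intro mult_right_mono_neg)
    moreover have "Re (y + s *\<^sub>R u) = Re y + s * \<gamma>" using u by simp
    ultimately have "Re (y + s *\<^sub>R u) \<le> norm (y + s *\<^sub>R u) * \<gamma>"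
      using y unfolding distrib_right by linarith
    then show "Re (of_real (2 * \<alpha>) * (x + t *\<^sub>R u) + 1) \<le>
        norm (of_real (2 * \<alpha>) * (x + t *\<^sub>R u) + 1) * cos (\<alpha> * pi / 2)"
      unfolding eq \<gamma>_def .
  qed
  define u v where "u = cis (- (\<alpha> * pi / 2))" and "v = cis (\<alpha> * pi / 2)"
  have uv: "u \<in> ?C - {0}" "v \<in> ?C - {0}"
    using mem [of u] mem [of v] by (auto simp: u_def v_def \<gamma>_def)
  have "u / v = cis (- (\<alpha> * pi))" by (simp add: u_def v_def cis_divide field_simps)
  \<comment> \<open>Adding a full turn brings the angle into the range \<open>[0, pi]\<close> of
    principal arguments.\<close>
  also have "\<dots> = cis (2 * pi - \<alpha> * pi)" by (simp add: complex_eq_iff cos_diff sin_diff)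
  finally have "Arg (u / v) = Arg (cis (2 * pi - \<alpha> * pi))" by simp
  also have "\<dots> = 2 * pi - \<alpha> * pi"
    using \<alpha> pi_gt_zero mult_right_mono [of \<alpha> 2 pi] mult_right_mono [of 1 \<alpha> pi] by (intro Arg_cis) auto
  finally have arg: "\<bar>Arg (u / v)\<bar> = 2 * pi - \<alpha> * pi" using \<alpha> by simp
  have "\<bar>Arg (u / v)\<bar> \<le> cone_angle ?C"
    unfolding cone_angle_def
  proof (rule cSup_upper)
    show "\<bar>Arg (u / v)\<bar> \<in> {\<bar>Arg (u / v)\<bar> |u v. u \<in> ?C - {0} \<and> v \<in> ?C - {0}}"
      using uv by blast
    have "\<bar>Arg x\<bar> \<le> pi" for x using Arg_le_pi [of x] mpi_less_Arg [of x] by simp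
    then show "bdd_above {\<bar>Arg (u / v)\<bar> |u v. u \<in> ?C - {0} \<and> v \<in> ?C - {0}}"
      by (intro bdd_aboveI [of _ pi]) auto
  qed
  then show ?thesis unfolding arg opening_angle_def by (simp add: algebra_simps)
qed

lemma extremal_map_in_concave_class:
  assumes \<alpha>: "1 \<le> \<alpha>" "\<alpha> \<le> 2"
  shows "extremal_map \<alpha> \<in> concave_class \<alpha>"
  unfolding concave_class_def
proof (intro CollectI conjI)
  show "extremal_map \<alpha> holomorphic_on ball 0 1"
    unfolding extremal_map_def using \<alpha> by (intro holomorphic_intros sector_map_holomorphic) auto
  show "extremal_map \<alpha> 0 = 0" by (simp add: extremal_map_def sector_map_0)
  show "deriv (extremal_map \<alpha>) 0 = 1"
    using DERIV_imp_deriv [OF extremal_map_has_field_derivative [of 0 \<alpha>]] \<alpha> by simp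
  show "inj_on (extremal_map \<alpha>) (ball 0 1)"
    using inj_on_sector_map_1 [of \<alpha>] \<alpha> by (simp add: inj_on_def extremal_map_def)
  show "opening_angle (extremal_map \<alpha> ` ball 0 1) \<le> pi * \<alpha>"
    by (rule opening_angle_extremal_map_le [OF \<alpha>])
  have "filterlim (\<lambda>z. of_real (1 / (2 * \<alpha>)) * (- 1 + sector_map 1 \<alpha> z)) at_infinity (at 1 within ball 0 1)"
    using \<alpha> sector_map_1_at_infinity [OF \<alpha>(1)]
    by (intro tendsto_mult_filterlim_at_infinity tendsto_add_filterlim_at_infinity tendsto_const) auto
  moreover have "(\<lambda>z. of_real (1 / (2 * \<alpha>)) * (- 1 + sector_map 1 \<alpha> z)) = extremal_map \<alpha>"
    by (auto simp: extremal_map_def divide_simps)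
  ultimately show "filterlim (extremal_map \<alpha>) at_infinity (at 1 within ball 0 1)" by simp
  \<comment> \<open>Because \<open>\<gamma> \<le> 0\<close>, \<open>Re X - \<gamma> * norm X\<close>
    is a convex function of \<open>X\<close>, and the complement is a sublevel set of it in affine
    coordinates.\<close>
  show "convex (- (extremal_map \<alpha> ` ball 0 1))"
    unfolding complement_extremal_image [OF \<alpha>]
  proof (rule convexI)
    fix x y :: complex and s t :: real
    assume x: "x \<in> {x. Re (of_real (2 * \<alpha>) * x + 1) \<le> norm (of_real (2 * \<alpha>) * x + 1) * cos (\<alpha> * pi / 2)}"
      and y: "y \<in> {x. Re (of_real (2 * \<alpha>) * x + 1) \<le> norm (of_real (2 * \<alpha>) * x + 1) * cos (\<alpha> * pi / 2)}"
      and st: "0 \<le> s" "0 \<le> t" "s + t = 1"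
    define X Y where "X = of_real (2 * \<alpha>) * x + 1" and "Y = of_real (2 * \<alpha>) * y + 1"
    define \<gamma> where "\<gamma> = cos (\<alpha> * pi / 2)"
    have XY: "Re X \<le> norm X * \<gamma>" "Re Y \<le> norm Y * \<gamma>"
      using x y by (auto simp: X_def Y_def \<gamma>_def)
    have \<gamma>: "\<gamma> \<le> 0" unfolding \<gamma>_def by (rule cos_obtuse_nonpos [OF \<alpha>])
    have t: "t = 1 - s" using st by simp
    have eq: "of_real (2 * \<alpha>) * (s *\<^sub>R x + t *\<^sub>R y) + 1 = s *\<^sub>R X + t *\<^sub>R Y"
      by (simp add: t X_def Y_def scaleR_conv_of_real algebra_simps)
    have "norm (s *\<^sub>R X + t *\<^sub>R Y) \<le> s * norm X + t * norm Y"
      using norm_triangle_ineq [of "s *\<^sub>R X" "t *\<^sub>R Y"] st by simp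
    then have "(s * norm X + t * norm Y) * \<gamma> \<le> norm (s *\<^sub>R X + t *\<^sub>R Y) * \<gamma>"
      using \<gamma> by (rule mult_right_mono_neg)
    moreover have "Re (s *\<^sub>R X + t *\<^sub>R Y) \<le> s * (norm X * \<gamma>) + t * (norm Y * \<gamma>)"
      using add_mono [OF mult_left_mono [OF XY(1) st(1)] mult_left_mono [OF XY(2) st(2)]] by simp
    ultimately have "Re (s *\<^sub>R X + t *\<^sub>R Y) \<le> norm (s *\<^sub>R X + t *\<^sub>R Y) * \<gamma>"
      by (simp add: distrib_right mult.assoc)
    then show "s *\<^sub>R x + t *\<^sub>R y \<in>
        {x. Re (of_real (2 * \<alpha>) * x + 1) \<le> norm (of_real (2 * \<alpha>) * x + 1) * cos (\<alpha> * pi / 2)}"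
      unfolding mem_Collect_eq eq \<gamma>_def .
  qed
qed

text \<open>The segment from 0 to the vertex \<open>- 1 / (2 * \<alpha>)\<close>, which lies outside
  the image, must meet the frontier.\<close>

lemma infdist_frontier_extremal_le:
  assumes \<alpha>: "1 \<le> \<alpha>" "\<alpha> \<le> 2"
  shows "infdist 0 (frontier (extremal_map \<alpha> ` ball 0 1)) \<le> 1 / (2 * \<alpha>)"
proof -
  let ?G = "extremal_map \<alpha> ` ball 0 1"
  define x0 :: complex where "x0 = - of_real (1 / (2 * \<alpha>))"
  have "extremal_map \<alpha> 0 = 0" by (simp add: extremal_map_def sector_map_0)
  then have "0 \<in> ?G" by (metis centre_in_ball image_eqI zero_less_one)
  moreover have "x0 \<in> - ?G"
    unfolding complement_extremal_image [OF \<alpha>] using \<alpha> by (simp add: x0_def)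
  ultimately have "closed_segment 0 x0 \<inter> frontier ?G \<noteq> {}"
    by (intro connected_Int_frontier) auto
  then obtain y where y: "y \<in> closed_segment 0 x0" "y \<in> frontier ?G" by blast
  have "infdist 0 (frontier ?G) \<le> dist 0 y" by (rule infdist_le [OF y(2)])
  also have "\<dots> \<le> norm x0"
    using segment_bound [OF y(1)] by simp
  also have "\<dots> = 1 / (2 * \<alpha>)" using \<alpha> by (simp add: x0_def norm_divide)
  finally show ?thesis .
qed

section \<open>Sharpness of the radius, and the root of the equation\<close>

lemma norm_powser_le:
  fixes c :: "nat \<Rightarrow> complex"
  assumes sums: "\<And>z. norm z < 1 \<Longrightarrow> (\<lambda>n. c n * z ^ n) sums f z" and c0: "c 0 = 0"
    and s: "0 \<le> s" "s < 1"
  shows "summable (\<lambda>n. norm (c (Suc n)) * s ^ Suc n)"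
    and "norm (f (of_real s)) \<le> (\<Sum>n. norm (c (Suc n)) * s ^ Suc n)"
proof -
  \<comment> \<open>Convergence at a larger radius \<open>t\<close> gives absolute convergence at
    \<open>s\<close>.\<close>
  obtain t where t: "s < t" "t < 1" using dense [OF s(2)] by blast
  have "summable (\<lambda>n. c n * of_real t ^ n)"
    using sums_summable [OF sums, of "of_real t"] s t by simp
  then have "summable (\<lambda>n. norm (c n * of_real s ^ n))"
    using s t by (intro powser_insidea) auto
  then have "summable (\<lambda>n. norm (c (Suc n) * of_real s ^ Suc n))"
    by (subst summable_Suc_iff)
  moreover have eq: "norm (c (Suc n) * of_real s ^ Suc n) = norm (c (Suc n)) * s ^ Suc n" for n
    using s by (simp only: norm_mult norm_power norm_of_real abs_of_nonneg)
  ultimately show *: "summable (\<lambda>n. norm (c (Suc n)) * s ^ Suc n)" by simp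
  have "(\<lambda>n. c (Suc n) * of_real s ^ Suc n) sums f (of_real s)"
    using sums [of "of_real s"] s c0 by (subst sums_Suc_iff) simp
  then have "f (of_real s) = (\<Sum>n. c (Suc n) * of_real s ^ Suc n)" by (rule sums_unique)
  then show "norm (f (of_real s)) \<le> (\<Sum>n. norm (c (Suc n)) * s ^ Suc n)"
    using summable_norm [of "\<lambda>n. c (Suc n) * of_real s ^ Suc n"] * unfolding eq by simp
qed

text \<open>For \<open>h = \<phi>\<close> extremal and \<open>g = k h\<close>, the left side at a
  real \<open>s > r0\<close> is at least \<open>(2 + k) * norm (h s)\<close> by the triangle
  inequality. This exceeds \<open>1 / (2 * \<alpha>)\<close>, an upper bound for the distance to the
  frontier.\<close>

lemma bohr_inequality_sharp:
  assumes K: "1 \<le> K" and \<alpha>: "1 \<le> \<alpha>" "\<alpha> \<le> 2" and r0: "0 < r0" "r0 < 1/3" "bohr_equation K \<alpha> r0"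
    and R: "r0 < R"
  shows "\<not> bohr_inequality_upto K \<alpha> R"
proof
  assume bohr: "bohr_inequality_upto K \<alpha> R"
  obtain s where s: "r0 < s" "s < min R 1" using dense [of r0 "min R 1"] R r0 by auto
  define k where "k = (K - 1) / (K + 1)"
  have k: "0 \<le> k" "k < 1" using K by (auto simp: k_def)
  define h where "h = extremal_map \<alpha>"
  define g where "g z = of_real k * h z" for z
  define a where "a = fps_nth (fps_expansion h 0)"
  define b where "b n = of_real k * a n" for n
  have \<phi>: "h \<in> concave_class \<alpha>" unfolding h_def by (rule extremal_map_in_concave_class [OF \<alpha>])
  then have hol: "h holomorphic_on ball 0 1" and h0: "h 0 = 0" by (auto simp: concave_class_def)
  have hexp: "h has_fps_expansion fps_expansion h 0"
    using hol by (intro has_fps_expansion_fps_expansion [of "ball 0 1"]) auto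
  have a: "(\<lambda>n. a n * z ^ n) sums h z" if "norm z < 1" for z
    unfolding a_def using hol that
    by (intro has_fps_expansion_imp_sums_complex [OF hexp, of 1]) (auto simp: one_ereal_def)
  have a0: "a 0 = 0" using has_fps_expansion_imp_0_eq_fps_nth_0 [OF hexp] h0 by (simp add: a_def)
  have b: "(\<lambda>n. b (Suc n) * z ^ Suc n) sums g z" if "norm z < 1" for z
  proof -
    have "(\<lambda>n. a (Suc n) * z ^ Suc n) sums h z"
      using a [OF that] a0 by (subst sums_Suc_iff) simp
    from sums_mult [OF this, of "of_real k"] show ?thesis
      by (simp add: b_def g_def mult_ac)
  qed
  have dh: "deriv h z \<noteq> 0" if "norm z < 1" for z
    using DERIV_imp_deriv [OF extremal_map_has_field_derivative [OF that, of \<alpha>]] \<alpha> by (simp add: h_def)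
  have dil: "dilatation h g z = of_real k" if "norm z < 1" for z
  proof -
    have "h field_differentiable at z"
      using hol that by (intro holomorphic_on_imp_differentiable_at [of _ "ball 0 1"]) auto
    then have "deriv g z = of_real k * deriv h z"
      unfolding g_def by (rule deriv_cmult)
    then show ?thesis using dh [OF that] by (simp add: dilatation_def)
  qed
  have harm: "harmonic_mapping (\<lambda>z. h z + cnj (g z)) h g"
    unfolding harmonic_mapping_def g_def by (auto intro!: holomorphic_intros hol)
  have sp: "sense_preserving h g" using dh dil k by (simp add: sense_preserving_def)
  have qc: "quasiconformal K h g" using dil k K unfolding quasiconformal_def k_def [symmetric] by simp
  have sub: "subordinate h h"
    unfolding subordinate_def by (intro exI [of _ "\<lambda>z. z"]) auto
  have s01: "0 \<le> s" "s < 1" "s \<le> R" using s r0 by auto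
  have ineq: "norm (h (of_real s)) + (\<Sum>n. (norm (a (Suc n)) + norm (b (Suc n))) * s ^ Suc n)
      \<le> infdist 0 (frontier (h ` ball 0 1))"
    using bohr [unfolded bohr_inequality_upto_def, rule_format, OF harm a b sp qc \<phi> sub, of "of_real s"]
      s01 h0 by simp
  define c where "c n = norm (a (Suc n)) * s ^ Suc n" for n
  have c: "summable c" "norm (h (of_real s)) \<le> suminf c"
    using norm_powser_le [OF a a0 s01(1,2)] by (simp_all add: c_def [abs_def])
  have "(norm (a (Suc n)) + norm (b (Suc n))) * s ^ Suc n = (1 + k) * c n" for n
    using k by (simp add: b_def c_def norm_mult algebra_simps)
  then have "(\<Sum>n. (norm (a (Suc n)) + norm (b (Suc n))) * s ^ Suc n) = (1 + k) * suminf c"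
    using suminf_mult [OF c(1)] by simp
  moreover have "(1 + k) * norm (h (of_real s)) \<le> (1 + k) * suminf c"
    using c(2) k by (intro mult_left_mono) auto
  ultimately have "(2 + k) * norm (h (of_real s)) \<le> 1 / (2 * \<alpha>)"
    using ineq infdist_frontier_extremal_le [OF \<alpha>] unfolding h_def [symmetric]
    by (simp add: algebra_simps)
  moreover have "norm (h (of_real s)) = (((1 + s) / (1 - s)) powr \<alpha> - 1) / (2 * \<alpha>)"
  proof -
    have "h (of_real s) = of_real ((((1 + s) / (1 - s)) powr \<alpha> - 1) / (2 * \<alpha>))"
      unfolding h_def extremal_map_def sector_map_of_real [OF s01(1,2)] by simp
    moreover have "1 powr \<alpha> \<le> ((1 + s) / (1 - s)) powr \<alpha>"
      using s01 \<alpha> by (intro powr_mono2) auto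
    ultimately show ?thesis using \<alpha> by (simp only: norm_of_real) simp
  qed
  ultimately have "((2 + k) * (((1 + s) / (1 - s)) powr \<alpha> - 1)) / (2 * \<alpha>) \<le> 1 / (2 * \<alpha>)"
    by (simp only: times_divide_eq_right)
  then have "(2 + k) * (((1 + s) / (1 - s)) powr \<alpha> - 1) \<le> 1"
    using \<alpha> by (subst (asm) divide_le_cancel) auto
  moreover have "2 + k = (3 * K + 1) / (K + 1)" using K by (simp add: k_def field_simps)
  then have "(2 + k) * (((1 + r0) / (1 - r0)) powr \<alpha> - 1) = 1"
    using r0(3) by (simp only: bohr_equation_def eq_iff_diff_eq_0 [symmetric])
  moreover have "(2 + k) * (((1 + r0) / (1 - r0)) powr \<alpha> - 1) <
      (2 + k) * (((1 + s) / (1 - s)) powr \<alpha> - 1)"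
    using ratio_powr_strict_mono [of r0 s \<alpha>] s r0 k \<alpha> by (intro mult_strict_left_mono) auto
  ultimately show False by linarith
qed

text \<open>The left side \<open>B\<close> is strictly increasing with \<open>B 0 = -1\<close>, and
  \<open>B (1/3) > 0\<close> because the quotient is 2 at \<open>1/3\<close>.\<close>

lemma ex1_bohr_root:
  assumes K: "1 \<le> K" and \<alpha>: "1 \<le> \<alpha>"
  shows "\<exists>!r. r \<in> {0<..<1/3} \<and> bohr_equation K \<alpha> r"
proof -
  define B where "B r = (3 * K + 1) / (K + 1) * (((1 + r) / (1 - r)) powr \<alpha> - 1) - 1" for r :: real
  have mono: "B r < B s" if "0 \<le> r" "r < s" "s < 1" for r s
    unfolding B_def using ratio_powr_strict_mono [OF that, of \<alpha>] K \<alpha>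
    by (intro diff_strict_right_mono mult_strict_left_mono) auto
  have B0: "B 0 < 0" by (simp add: B_def)
  have B1: "0 < B (1/3)"
  proof -
    have "2 powr 1 \<le> (2::real) powr \<alpha>" using \<alpha> by (intro powr_mono) auto
    then have "2 * 1 \<le> (3 * K + 1) / (K + 1) * (2 powr \<alpha> - 1)"
      using bohr_factor_ge_2 [OF K] by (intro mult_mono) auto
    then show ?thesis by (simp add: B_def)
  qed
  have "continuous_on {0..1/3} B"
    unfolding B_def by (intro continuous_intros) auto
  then obtain r where r: "0 \<le> r" "r \<le> 1/3" "B r = 0"
    using IVT' [of B 0 0 "1/3"] B0 B1 by auto
  show ?thesis
  proof (rule ex1I)
    have "r \<noteq> 0" "r \<noteq> 1/3" using r(3) B0 B1 by (metis less_irrefl)+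
    moreover have "bohr_equation K \<alpha> r"
      using r(3) unfolding bohr_equation_def B_def .
    ultimately show "r \<in> {0<..<1/3} \<and> bohr_equation K \<alpha> r"
      using r by simp
    fix x assume x: "x \<in> {0<..<1/3} \<and> bohr_equation K \<alpha> x"
    then have "B x = 0" unfolding bohr_equation_def B_def by blast
    then show "x = r" using mono [of x r] mono [of r x] x r by (cases x r rule: linorder_cases) auto
  qed
qed

theorem theorem5p2:
  fixes K \<alpha> :: real
  assumes "K \<ge> 1" and "1 \<le> \<alpha>" and "\<alpha> \<le> 2"
  shows "(\<exists>!r. r \<in> {0<..<1/3} \<and> bohr_equation K \<alpha> r) \<and>
    (\<forall>r0. r0 \<in> {0<..<1/3} \<and> bohr_equation K \<alpha> r0 \<longrightarrow>
       bohr_inequality_upto K \<alpha> r0 \<and>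
       (\<forall>R>r0. \<not> bohr_inequality_upto K \<alpha> R))"
proof (intro conjI allI impI)
  show "\<exists>!r. r \<in> {0<..<1/3} \<and> bohr_equation K \<alpha> r"
    by (rule ex1_bohr_root [OF assms(1,2)])
  fix r0 assume r0: "r0 \<in> {0<..<1/3} \<and> bohr_equation K \<alpha> r0"
  show "bohr_inequality_upto K \<alpha> r0"
    using bohr_inequality_at_root [OF assms] r0 by simp
  show "\<not> bohr_inequality_upto K \<alpha> R" if "r0 < R" for R
    using bohr_inequality_sharp [OF assms _ _ _ that] r0 by simp
qed

end
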